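(* For integers $s\ge0$, $p\ge1$ and $k\ge0$, $$\sum_{n\ge0}\left[\frac{4^n}{\binom{2n}{n}}\right]^2\frac{t^\star_{n+1}(1_k)\zeta_n(2_{p-1})}{(2n+1)^{s+3}}\in\mathrm{CMZV}^4_{s+2p+k+1}.$$
   Context: For $n\in\mathbb{N}_0$: $t^\star_n(1_k)=\sum_{n\ge n_1\ge\cdots\ge n_k>0}\prod_j(2n_j-1)^{-1}$ and $\zeta_n(2_{p-1})=\sum_{n\ge n_1>\cdots>n_{p-1}>0}\prod_j n_j^{-2}$, each equal to $1$ for the empty string and $0$ when the sum is empty. $\mathrm{CMZV}^4_w$ is the $\mathbb{Q}$-span of colored multiple zeta values $\sum_{n_1>\cdots>n_r>0}\prod_j z_j^{n_j}n_j^{-a_j}$ of weight $w$ with all $z_j$ fourth roots of unity and $(a_1,z_1)\ne(1,1)$. *)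

theory Defs
  imports "HOL-Analysis.Analysis"
begin

text \<open>Positions are 0-based: \<open>ns ! j\<close> is the summation variable $n_{j+1}$. For the empty string
  the only index list is \<open>[]\<close>, so every truncated sum below equals 1; if there is no admissible
  index list the sum is 0.\<close>

definition strict_chains :: "nat \<Rightarrow> nat \<Rightarrow> nat list set" where
  "strict_chains r n = {ns. length ns = r \<and> sorted_wrt (>) ns \<and> set ns \<subseteq> {1..n}}"

definition weak_chains :: "nat \<Rightarrow> nat \<Rightarrow> nat list set" where
  "weak_chains r n = {ns. length ns = r \<and> sorted_wrt (\<ge>) ns \<and> set ns \<subseteq> {1..n}}"

definition t_star :: "nat \<Rightarrow> nat list \<Rightarrow> real" where
  "t_star n as = (\<Sum>ns \<in> weak_chains (length as) n.
     \<Prod>j<length as. 1 / (2 * real (ns ! j) - 1) ^ (as ! j))"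

definition zeta_trunc :: "nat \<Rightarrow> nat list \<Rightarrow> real" where
  "zeta_trunc n as = (\<Sum>ns \<in> strict_chains (length as) n.
     \<Prod>j<length as. 1 / real (ns ! j) ^ (as ! j))"

text \<open>An index of a colored multiple zeta value is the list of the pairs $(a_j, z_j)$.\<close>

definition cmzv_trunc :: "(nat \<times> complex) list \<Rightarrow> nat \<Rightarrow> complex" where
  "cmzv_trunc I n = (\<Sum>ns \<in> strict_chains (length I) n.
     \<Prod>j<length I. snd (I ! j) ^ (ns ! j) / of_nat (ns ! j) ^ fst (I ! j))"

definition cmzv_indices :: "nat \<Rightarrow> nat \<Rightarrow> (nat \<times> complex) list set" where
  "cmzv_indices N w = {I. (\<forall>(a, z) \<in> set I. a \<ge> 1 \<and> z ^ N = 1)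
     \<and> sum_list (map fst I) = w \<and> (I \<noteq> [] \<longrightarrow> hd I \<noteq> (1, 1))}"

abbreviation rat_scale :: "rat \<Rightarrow> complex \<Rightarrow> complex" where
  "rat_scale q x \<equiv> of_rat q * x"

lemma vector_space_rat_scale: "vector_space rat_scale"
  by unfold_locales (simp_all add: algebra_simps of_rat_add of_rat_mult)

text \<open>The series of a colored multiple zeta value converges only conditionally if $a_1 = 1$; its
  value is the limit of the partial sums over $n_1 \le n$. The span is that of the
  $\mathbb{Q}$-vector space of complex numbers.\<close>

definition CMZV :: "nat \<Rightarrow> nat \<Rightarrow> complex set" where
  "CMZV N w = module.span rat_scale
     {x. \<exists>I \<in> cmzv_indices N w. cmzv_trunc I \<longlonglongrightarrow> x}"

end

theory Submission imports Defs "HOL-Real_Asymp.Real_Asymp" begin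

text \<open>The coefficients of \<open>\<theta> ^ (2 * p - 1) / cos \<theta>\<close> in powers of \<open>sin \<theta>\<close> are rational
  multiples, independent of \<open>n\<close>, of \<open>4 ^ n / ((2 * n choose n) * (2 * n + 1)) * \<zeta>\<^sub>n(2\<^bsub>p-1\<^esub>)\<close>,
  and the integral of \<open>sin \<theta> ^ (2 * n + 1) * (- ln (cos \<theta>)) ^ k\<close> over \<open>[0, \<pi> / 2]\<close> is
  \<open>k! * 4 ^ n / ((2 * n choose n) * (2 * n + 1)) * t\<^sup>\<star>\<^bsub>n+1\<^esub>(1\<^sub>k)\<close>. Hence the sum is an
  iterated integral in the forms \<open>d\<theta>\<close>, \<open>d\<theta> / sin \<theta>\<close>, \<open>cot \<theta> d\<theta>\<close> and
  \<open>tan \<theta> d\<theta>\<close>. The substitution \<open>t = tan (\<theta> / 2)\<close> maps \<open>[0, \<pi> / 2]\<close> to \<open>[0, 1]\<close> and turns them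
  into combinations of \<open>dt / (a - t)\<close> with \<open>a = 0\<close> or \<open>a ^ 4 = 1\<close>; the coefficients are rational
  except for a factor \<open>\<i>\<close> with each of the \<open>2 * p\<close> copies of \<open>d\<theta>\<close>. The outermost form is
  \<open>d\<theta>\<close>, so the outermost letters are \<open>\<plusminus>\<i>\<close> and all multiple polylogarithms that occur
  converge at 1.\<close>

section \<open>Truncated sums: recursions and generating coefficients\<close>

lemma finite_strict_chains [simp]: "finite (strict_chains r n)"
  by (rule finite_subset[OF _ finite_lists_length_eq[of "{1..n}" r]]) (auto simp: strict_chains_def)

lemma finite_weak_chains [simp]: "finite (weak_chains r n)"
  by (rule finite_subset[OF _ finite_lists_length_eq[of "{1..n}" r]]) (auto simp: weak_chains_def)

lemma strict_chains_0 [simp]: "strict_chains 0 n = {[]}"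
  by (auto simp: strict_chains_def)

lemma weak_chains_0 [simp]: "weak_chains 0 n = {[]}"
  by (auto simp: weak_chains_def)

lemma strict_chains_Suc_0 [simp]: "strict_chains (Suc r) 0 = {}"
  by (auto simp: strict_chains_def)

lemma weak_chains_Suc_0 [simp]: "weak_chains (Suc r) 0 = {}"
  by (auto simp: weak_chains_def)

lemma strict_chains_Suc_Suc:
  "strict_chains (Suc r) (Suc n) = strict_chains (Suc r) n \<union> (#) (Suc n) ` strict_chains r n"
proof (intro equalityI subsetI)
  fix ns assume *: "ns \<in> strict_chains (Suc r) (Suc n)"
  then obtain m ms where ns: "ns = m # ms"
    by (cases ns) (auto simp: strict_chains_def)
  show "ns \<in> strict_chains (Suc r) n \<union> (#) (Suc n) ` strict_chains r n"
  proof (cases "m = Suc n")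
    case True
    then show ?thesis using * ns by (auto simp: strict_chains_def subset_iff intro!: imageI)
  next
    case False
    then show ?thesis using * ns by (force simp: strict_chains_def subset_iff)
  qed
qed (force simp: strict_chains_def subset_iff)

text \<open>Split by whether the largest entry is \<open>Suc n\<close>. Repetition is allowed, so
  behind a head \<open>Suc n\<close> the tail still ranges up to \<open>Suc n\<close>, unlike in the
  strict case.\<close>

lemma weak_chains_Suc_Suc:
  "weak_chains (Suc r) (Suc n) = weak_chains (Suc r) n \<union> (#) (Suc n) ` weak_chains r (Suc n)"
proof (intro equalityI subsetI)
  fix ns assume *: "ns \<in> weak_chains (Suc r) (Suc n)"
  then obtain m ms where ns: "ns = m # ms"
    by (cases ns) (auto simp: weak_chains_def)
  show "ns \<in> weak_chains (Suc r) n \<union> (#) (Suc n) ` weak_chains r (Suc n)"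
  proof (cases "m = Suc n")
    case True
    then show ?thesis using * ns by (auto simp: weak_chains_def subset_iff intro!: imageI)
  next
    case False
    then show ?thesis using * ns by (force simp: weak_chains_def subset_iff)
  qed
qed (force simp: weak_chains_def subset_iff)

lemma sum_strict_chains_Suc_Suc:
  fixes g :: "nat \<Rightarrow> nat \<Rightarrow> 'a :: comm_semiring_1"
  shows "(\<Sum>ns \<in> strict_chains (Suc r) (Suc n). \<Prod>j<Suc r. g j (ns ! j)) =
    (\<Sum>ns \<in> strict_chains (Suc r) n. \<Prod>j<Suc r. g j (ns ! j)) +
    g 0 (Suc n) * (\<Sum>ns \<in> strict_chains r n. \<Prod>j<r. g (Suc j) (ns ! j))"
proof -
  have "strict_chains (Suc r) n \<inter> (#) (Suc n) ` strict_chains r n = {}"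
    by (auto simp: strict_chains_def)
  then show ?thesis
    unfolding strict_chains_Suc_Suc
    by (subst sum.union_disjoint)
       (auto simp: sum.reindex prod.lessThan_Suc_shift sum_distrib_left simp del: prod.lessThan_Suc)
qed

lemma sum_weak_chains_Suc_Suc:
  fixes g :: "nat \<Rightarrow> nat \<Rightarrow> 'a :: comm_semiring_1"
  shows "(\<Sum>ns \<in> weak_chains (Suc r) (Suc n). \<Prod>j<Suc r. g j (ns ! j)) =
    (\<Sum>ns \<in> weak_chains (Suc r) n. \<Prod>j<Suc r. g j (ns ! j)) +
    g 0 (Suc n) * (\<Sum>ns \<in> weak_chains r (Suc n). \<Prod>j<r. g (Suc j) (ns ! j))"
proof -
  have "weak_chains (Suc r) n \<inter> (#) (Suc n) ` weak_chains r (Suc n) = {}"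
    by (auto simp: weak_chains_def)
  then show ?thesis
    unfolding weak_chains_Suc_Suc
    by (subst sum.union_disjoint)
       (auto simp: sum.reindex prod.lessThan_Suc_shift sum_distrib_left simp del: prod.lessThan_Suc)
qed

lemma t_star_Nil [simp]: "t_star n [] = 1"
  by (simp add: t_star_def)

lemma t_star_Cons_0 [simp]: "t_star 0 (a # as) = 0"
  by (simp add: t_star_def)

lemma t_star_Cons_Suc:
  "t_star (Suc n) (a # as) = t_star n (a # as) + t_star (Suc n) as / (2 * real n + 1) ^ a"
  using sum_weak_chains_Suc_Suc[of "\<lambda>j m. 1 / (2 * real m - 1) ^ ((a # as) ! j)" "length as" n]
  by (simp add: t_star_def add.commute del: prod.lessThan_Suc)

lemma zeta_trunc_Nil [simp]: "zeta_trunc n [] = 1"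
  by (simp add: zeta_trunc_def)

lemma zeta_trunc_Cons_0 [simp]: "zeta_trunc 0 (a # as) = 0"
  by (simp add: zeta_trunc_def)

lemma zeta_trunc_Cons_Suc:
  "zeta_trunc (Suc n) (a # as) = zeta_trunc n (a # as) + zeta_trunc n as / real (Suc n) ^ a"
  using sum_strict_chains_Suc_Suc[of "\<lambda>j m. 1 / real m ^ ((a # as) ! j)" "length as" n]
  by (simp add: zeta_trunc_def del: prod.lessThan_Suc)

lemma cmzv_trunc_Nil [simp]: "cmzv_trunc [] n = 1"
  by (simp add: cmzv_trunc_def)

lemma cmzv_trunc_Cons_0 [simp]: "cmzv_trunc (x # I) 0 = 0"
  by (simp add: cmzv_trunc_def)

lemma cmzv_trunc_Cons_Suc:
  "cmzv_trunc ((a, z) # I) (Suc n) =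
     cmzv_trunc ((a, z) # I) n + z ^ Suc n / of_nat (Suc n) ^ a * cmzv_trunc I n"
  using sum_strict_chains_Suc_Suc[of "\<lambda>j m. snd (((a, z) # I) ! j) ^ m / of_nat m ^ fst (((a, z) # I) ! j)" "length I" n]
  by (simp add: cmzv_trunc_def del: prod.lessThan_Suc)

text \<open>The part of the multiple sum in which the outermost variable equals \<open>m\<close>.
  These are the Taylor coefficients at 0 of the multiple polylogarithm in one variable; the empty
  index contributes the constant 1.\<close>

fun cmzv_coeff :: "(nat \<times> complex) list \<Rightarrow> nat \<Rightarrow> complex" where
  "cmzv_coeff [] m = (if m = 0 then 1 else 0)"
| "cmzv_coeff ((a, z) # I) m = (if m = 0 then 0 else z ^ m / of_nat m ^ a * cmzv_trunc I (m - 1))"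

lemma cmzv_trunc_eq_sum_coeff: "cmzv_trunc I n = (\<Sum>m\<le>n. cmzv_coeff I m)"
proof (cases I)
  case Nil
  show ?thesis by (induction n) (auto simp: Nil)
next
  case (Cons x J)
  show ?thesis unfolding Cons by (cases x, induction n) (auto simp: cmzv_trunc_Cons_Suc)
qed

text \<open>All words of weight \<open>n\<close>, divergent ones included: inside the unit disc
  every such polylogarithm converges, and the condition on the first pair enters only at
  \<open>t = 1\<close>.\<close>

definition level4_indices :: "nat \<Rightarrow> (nat \<times> complex) list set" where
  "level4_indices n = {I. (\<forall>(a, z) \<in> set I. a \<ge> 1 \<and> z ^ 4 = 1) \<and> sum_list (map fst I) = n}"

section \<open>Growth of the truncated sums and convergence at the boundary\<close>

lemma norm_fourth_root: "z ^ 4 = 1 \<Longrightarrow> norm (z::complex) = 1"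
  by (metis norm_one norm_power norm_ge_zero power_eq_1_iff zero_neq_numeral)

text \<open>The induction step for bounding the sum of \<open>1 / sqrt j\<close> over
  \<open>j \<le> m\<close> by \<open>2 * sqrt m\<close>. It amounts to
  \<open>(y - x)\<^sup>2 \<ge> 0\<close> for two square roots whose squares differ by 1.\<close>

lemma sqrt_recurrence: "2 * sqrt (real m) + 1 / sqrt (real (Suc m)) \<le> 2 * sqrt (real (Suc m))"
proof -
  define x y where "x = sqrt (real m)" and "y = sqrt (real (Suc m))"
  have "x \<ge> 0" "y > 0" "y\<^sup>2 = x\<^sup>2 + 1" by (auto simp: x_def y_def)
  moreover have "0 \<le> (y - x)\<^sup>2" by simp
  ultimately have "2 * x * y + 1 \<le> 2 * y * y"
    by (simp add: power2_eq_square algebra_simps)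
  then have "2 * x + 1 / y \<le> 2 * y" using \<open>y > 0\<close> by (simp add: field_simps)
  then show ?thesis by (simp add: x_def y_def)
qed

lemma norm_cmzv_term_le:
  assumes "z ^ 4 = 1" "a \<ge> 1" "norm (c::complex) \<le> B * sqrt (real (Suc m))"
  shows "norm (z ^ Suc m / of_nat (Suc m) ^ a * c) \<le> B / sqrt (real (Suc m))"
proof -
  have "real (Suc m) ^ 1 \<le> real (Suc m) ^ a"
    using assms(2) by (intro power_increasing) auto
  then have "norm (z ^ Suc m / of_nat (Suc m) ^ a * c) \<le> norm c / real (Suc m)"
    using norm_fourth_root[OF assms(1)]
    by (simp only: norm_mult norm_divide norm_power norm_of_nat)
       (auto intro!: divide_left_mono simp: mult_less_0_iff)
  also have "\<dots> \<le> B * sqrt (real (Suc m)) / real (Suc m)"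
    using assms(3) by (intro divide_right_mono) auto
  also have "\<dots> = B / sqrt (real (Suc m))"
    by (simp add: real_div_sqrt field_simps flip: power2_eq_square del: of_nat_Suc)
  finally show ?thesis .
qed

text \<open>Square root growth reproduces itself: division by the outer variable turns
  \<open>sqrt\<close> into \<open>1 / sqrt\<close>, and summation turns this back into at most
  \<open>2 * sqrt\<close>. Each level of nesting costs a factor 2.\<close>

lemma norm_cmzv_trunc_le:
  assumes "\<forall>(a, z) \<in> set I. a \<ge> 1 \<and> z ^ 4 = 1"
  shows "norm (cmzv_trunc I m) \<le> 2 ^ length I * sqrt (real (Suc m))"
  using assms
proof (induction I arbitrary: m)
  case (Cons x I)
  obtain a z where x: "x = (a, z)" by (cases x)
  have az: "a \<ge> 1" "z ^ 4 = 1" using Cons.prems x by auto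
  have "norm (cmzv_trunc (x # I) m) \<le> 2 ^ length I * (2 * sqrt (real m))"
  proof (induction m)
    case (Suc m)
    have "norm (cmzv_trunc (x # I) (Suc m)) \<le> norm (cmzv_trunc (x # I) m) +
        2 ^ length I / sqrt (real (Suc m))"
      unfolding x cmzv_trunc_Cons_Suc
      using Cons az by (intro order_trans[OF norm_triangle_ineq] add_left_mono norm_cmzv_term_le) auto
    also have "\<dots> \<le> 2 ^ length I * (2 * sqrt (real m) + 1 / sqrt (real (Suc m)))"
      using Suc by (simp add: algebra_simps)
    also have "\<dots> \<le> 2 ^ length I * (2 * sqrt (real (Suc m)))"
      using sqrt_recurrence by (intro mult_left_mono) auto
    finally show ?case .
  qed auto
  also have "\<dots> \<le> 2 ^ length (x # I) * sqrt (real (Suc m))" by simp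
  finally show ?case .
qed auto

lemma norm_cmzv_coeff_le:
  assumes "I \<in> level4_indices n"
  shows "norm (cmzv_coeff I m) \<le> 2 ^ length I"
proof (cases I)
  case (Cons x J)
  obtain a z where x: "x = (a, z)" by (cases x)
  show ?thesis
  proof (cases m)
    case (Suc k)
    have "norm (cmzv_coeff I m) \<le> 2 ^ length J / sqrt (real (Suc k))"
      using norm_cmzv_term_le[of z a "cmzv_trunc J k" "2 ^ length J" k] norm_cmzv_trunc_le[of J k] assms
      by (auto simp: Cons x Suc level4_indices_def)
    also have "\<dots> \<le> 2 ^ length J / 1"
      by (intro divide_left_mono) auto
    also have "\<dots> \<le> 2 ^ length I" by (simp add: Cons)
    finally show ?thesis .
  qed (auto simp: Cons x)
qed auto

text \<open>Summation by parts: multiplying the power series with coefficients \<open>z ^ n * b n\<close> by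
  \<open>1 - z * t\<close> makes it absolutely convergent up to \<open>t = 1\<close>.\<close>

lemma abel_bounded_variation:
  fixes z :: complex and b :: "nat \<Rightarrow> complex"
  assumes z: "norm z = 1" "z \<noteq> 1" and b: "b \<longlonglongrightarrow> 0" "b 0 = 0"
    and bv: "summable (\<lambda>n. norm (b (Suc n) - b n))"
  obtains x where "(\<lambda>N. \<Sum>n\<le>N. z ^ n * b n) \<longlonglongrightarrow> x"
    "((\<lambda>t. \<Sum>n. z ^ n * b n * of_real t ^ n) \<longlongrightarrow> x) (at_left (1::real))"
proof
  define d where "d n = (if n = 0 then 0 else b n - b (n - 1))" for n
  have d_Suc: "d (Suc n) = b (Suc n) - b n" and d_0: "d 0 = 0" for n
    by (simp_all add: d_def)
  have sd: "summable (\<lambda>n. norm (d n))"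
    using summable_Suc_iff[of "\<lambda>n. norm (d n)"] bv by (simp add: d_Suc)
  define D where "D t = (\<Sum>n. d n * z ^ n * of_real t ^ n)" for t :: real
  \<comment> \<open>Multiplication by \<open>1 - z * u\<close> replaces \<open>b\<close> by its
    differences \<open>d\<close>, which are absolutely summable, up to one boundary term that
    vanishes in the limit because \<open>b\<close> tends to 0.\<close>
  have partial: "(1 - z * u) * (\<Sum>n\<le>N. z ^ n * b n * u ^ n) =
      (\<Sum>n\<le>N. d n * z ^ n * u ^ n) - z ^ Suc N * b N * u ^ Suc N" for N u
    by (induction N) (simp_all add: d_Suc d_0 b algebra_simps)
  have unif: "uniform_limit {0..1} (\<lambda>N t. \<Sum>n<N. d n * z ^ n * of_real t ^ n) D sequentially"
    unfolding D_def
    by (rule Weierstrass_m_test[OF _ sd])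
       (auto simp: norm_mult norm_power z intro!: mult_left_le power_le_one)
  have contD: "continuous_on {0..1} D"
    by (rule uniform_limit_theorem[OF _ unif]) (auto intro!: always_eventually continuous_intros)
  have lim: "(\<lambda>N. \<Sum>n\<le>N. d n * z ^ n * of_real t ^ n) \<longlonglongrightarrow> D t" if "t \<in> {0..1}" for t
    using tendsto_uniform_limitI[OF unif that] by (simp add: LIMSEQ_lessThan_iff_atMost)
  have tail: "(\<lambda>N. z ^ Suc N * b N * of_real t ^ Suc N) \<longlonglongrightarrow> 0" if "t \<in> {0..1}" for t
  proof (rule Lim_null_comparison[OF _ tendsto_norm_zero[OF b(1)]])
    have "norm (z ^ Suc N * b N * of_real t ^ Suc N) \<le> norm (b N)" for N
      using that unfolding norm_mult norm_power by (auto simp: z intro!: mult_left_le mult_le_one power_le_one)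
    then show "\<forall>\<^sub>F N in sequentially. norm (z ^ Suc N * b N * of_real t ^ Suc N) \<le> norm (b N)"
      by simp
  qed
  have nz: "1 - z * of_real t \<noteq> 0" if "t \<in> {0..1}" for t
  proof
    assume "1 - z * of_real t = 0"
    then have "norm (z * of_real t) = 1" by (metis eq_iff_diff_eq_0 norm_one)
    then have "t = 1" using z that by (simp add: norm_mult)
    with \<open>1 - z * of_real t = 0\<close> z show False by simp
  qed
  \<comment> \<open>The same quotient is obtained on all of \<open>{0..1}\<close>:
    \<open>t = 1\<close> gives the value of the series, and continuity of \<open>D\<close> makes it
    the limit from the left.\<close>
  have main: "(\<lambda>N. \<Sum>n\<le>N. z ^ n * b n * of_real t ^ n) \<longlonglongrightarrow> D t / (1 - z * of_real t)"
    if "t \<in> {0..1}" for t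
  proof -
    have "(\<lambda>N. ((\<Sum>n\<le>N. d n * z ^ n * of_real t ^ n) - z ^ Suc N * b N * of_real t ^ Suc N) /
       (1 - z * of_real t)) \<longlonglongrightarrow> (D t - 0) / (1 - z * of_real t)"
      by (intro tendsto_intros lim tail that nz)
    then show ?thesis unfolding partial[symmetric] using nz[OF that] by simp
  qed
  show "(\<lambda>N. \<Sum>n\<le>N. z ^ n * b n) \<longlonglongrightarrow> D 1 / (1 - z)"
    using main[of 1] by simp
  have "((\<lambda>t. D t / (1 - z * of_real t)) \<longlongrightarrow> D 1 / (1 - z * of_real 1)) (at 1 within {0..1})"
    using contD nz[of 1] by (intro tendsto_intros) (auto simp: continuous_on_def)
  then have "((\<lambda>t. D t / (1 - z * of_real t)) \<longlongrightarrow> D 1 / (1 - z)) (at_left 1)"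
    by (simp add: at_within_Icc_at_left)
  then show "((\<lambda>t. \<Sum>n. z ^ n * b n * of_real t ^ n) \<longlongrightarrow> D 1 / (1 - z)) (at_left (1::real))"
  proof (rule Lim_transform_eventually)
    have "\<forall>\<^sub>F t in at_left (1::real). t \<in> {0<..<1}"
      by (rule eventually_at_leftI[of 0]) auto
    then show "\<forall>\<^sub>F t in at_left 1. D t / (1 - z * of_real t) = (\<Sum>n. z ^ n * b n * of_real t ^ n)"
    proof eventually_elim
      case (elim t)
      then have "(\<lambda>n. z ^ n * b n * of_real t ^ n) sums (D t / (1 - z * of_real t))"
        using main[of t] by (simp add: sums_def_le)
      then show ?case by (simp add: sums_iff)
    qed
  qed
qed

section \<open>Multiple polylogarithms and their primitives\<close>

lemma one_le_fps_conv_radius: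
  fixes f :: "'a :: {banach, real_normed_field} fps"
  assumes "\<And>n. norm (fps_nth f n) \<le> B * real (Suc n)"
  shows "1 \<le> fps_conv_radius f"
  unfolding fps_conv_radius_def
proof (rule conv_radius_geI_ex)
  fix r :: real assume r: "0 < r" "ereal r < 1"
  have "summable (\<lambda>n. B * (real (Suc n) * r ^ n))"
    using geometric_deriv_sums[of r] r by (intro summable_mult) (auto simp: sums_iff)
  then have "summable (\<lambda>n. fps_nth f n * of_real r ^ n)"
  proof (rule summable_comparison_test'[where N = 0])
    show "norm (fps_nth f n * of_real r ^ n) \<le> B * (real (Suc n) * r ^ n)" for n
      using mult_right_mono[OF assms[of n], of "r ^ n"] r
      by (simp add: norm_mult norm_power mult.assoc del: of_nat_Suc)
  qed
  then show "\<exists>z. norm z = r \<and> summable (\<lambda>n. fps_nth f n * z ^ n)"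
    using r by (intro exI[of _ "of_real r"]) auto
qed

definition polylog :: "(nat \<times> complex) list \<Rightarrow> real \<Rightarrow> complex" where
  "polylog I t = eval_fps (Abs_fps (cmzv_coeff I)) (of_real t)"

text \<open>The derivative is prescribed only on the open interval because forms such as
  \<open>dt / t\<close> are singular at 0; continuity and the value at 0 then still determine
  \<open>h\<close> on \<open>{0..<1}\<close>.\<close>

definition primitive :: "(real \<Rightarrow> complex) \<Rightarrow> (real \<Rightarrow> complex) \<Rightarrow> bool" where
  "primitive h f \<longleftrightarrow> h 0 = 0 \<and> continuous_on {0..<1} h \<and>
     (\<forall>t\<in>{0<..<1}. (h has_vector_derivative f t) (at t))"

lemma primitive_cong: "primitive h f \<Longrightarrow> (\<And>t. t \<in> {0<..<1} \<Longrightarrow> f t = g t) \<Longrightarrow> primitive h g"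
  by (auto simp: primitive_def)

lemma primitive_add: "primitive h f \<Longrightarrow> primitive k g \<Longrightarrow> primitive (\<lambda>t. h t + k t) (\<lambda>t. f t + g t)"
  by (auto simp: primitive_def intro!: continuous_intros derivative_intros)

lemma primitive_cmult: "primitive h f \<Longrightarrow> primitive (\<lambda>t. c * h t) (\<lambda>t. c * f t)"
  by (auto simp: primitive_def intro!: continuous_intros derivative_intros)

lemma primitive_unique:
  assumes "primitive h f" "primitive k f" "t \<in> {0..<1}"
  shows "h t = k t"
proof -
  have "(\<lambda>t. h t - k t) t = 0"
  proof (rule has_derivative_zero_unique_strong_convex[where S = "{0..<1::real}" and K = "{0}" and c = 0])
    fix x :: real assume "x \<in> {0..<1} - {0}"
    then have "((\<lambda>t. h t - k t) has_vector_derivative (f x - f x)) (at x)"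
      using assms by (intro derivative_intros) (auto simp: primitive_def)
    then show "((\<lambda>t. h t - k t) has_derivative (\<lambda>_. 0)) (at x within {0..<1})"
      by (simp add: has_vector_derivative_def has_derivative_at_withinI)
  qed (use assms in \<open>auto simp: primitive_def intro!: continuous_intros\<close>)
  then show ?thesis by simp
qed

lemma one_le_conv_radius_polylog:
  assumes "I \<in> level4_indices n"
  shows "1 \<le> fps_conv_radius (Abs_fps (cmzv_coeff I))"
proof (rule one_le_fps_conv_radius)
  fix m
  have "norm (cmzv_coeff I m) \<le> 2 ^ length I * 1"
    using norm_cmzv_coeff_le[OF assms] by simp
  also have "\<dots> \<le> 2 ^ length I * real (Suc m)"
    by (intro mult_left_mono) auto
  finally show "norm (fps_nth (Abs_fps (cmzv_coeff I)) m) \<le> 2 ^ length I * real (Suc m)"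
    by simp
qed

text \<open>The differential equation is asked of the formal derivative, so that it can be checked
  by comparing coefficients. A nonempty index has no constant term, which gives the value 0 at
  0.\<close>

lemma primitive_polylog:
  assumes "I \<in> level4_indices n" "I \<noteq> []"
    and "\<And>t. norm t < 1 \<Longrightarrow> t \<noteq> 0 \<Longrightarrow> eval_fps (fps_deriv (Abs_fps (cmzv_coeff I))) t = f t"
  shows "primitive (polylog I) (\<lambda>t. f (of_real t))"
proof -
  let ?F = "Abs_fps (cmzv_coeff I)"
  have R: "norm t < fps_conv_radius ?F" if "norm t < 1" for t
    using one_le_conv_radius_polylog[OF assms(1)] that by (metis ereal_less(3) order_less_le_trans)
  have deriv: "(polylog I has_vector_derivative eval_fps (fps_deriv ?F) (of_real t)) (at t)" if "t \<in> {0..<1}" for t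
  proof -
    have "(eval_fps ?F has_field_derivative eval_fps (fps_deriv ?F) (of_real t)) (at (of_real t))"
      using that by (intro has_field_derivative_eval_fps R) auto
    from has_vector_derivative_real_field[OF this] show ?thesis
      by (simp add: polylog_def[abs_def])
  qed
  have "polylog I 0 = 0"
    using assms(2) by (cases I) (auto simp: polylog_def eval_fps_at_0)
  moreover have "continuous_on {0..<1} (polylog I)"
    using deriv by (intro continuous_at_imp_continuous_on ballI has_vector_derivative_continuous)
  moreover have "(polylog I has_vector_derivative f (of_real t)) (at t)" if "t \<in> {0<..<1}" for t
    using deriv[of t] that assms(3)[of "of_real t"] by simp
  ultimately show ?thesis by (simp add: primitive_def)
qed

text \<open>Raising the first exponent by one divides the coefficient of \<open>t ^ m\<close> by
  \<open>m\<close>, which is integration against \<open>dt / t\<close>. Positive weight ensures that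
  there is a first exponent to raise.\<close>

lemma primitive_polylog_at_0:
  assumes "I \<in> level4_indices n" "n > 0"
  obtains J where "J \<in> level4_indices (Suc n)"
    "primitive (polylog J) (\<lambda>t. polylog I t / of_real t)"
proof -
  obtain a z K where I: "I = (a, z) # K"
    using assms by (cases I) (auto simp: level4_indices_def)
  define J where "J = (Suc a, z) # K"
  have J: "J \<in> level4_indices (Suc n)"
    using assms by (auto simp: I J_def level4_indices_def)
  let ?F = "Abs_fps (cmzv_coeff I)" and ?G = "Abs_fps (cmzv_coeff J)"
  have "primitive (polylog J) (\<lambda>t. (\<lambda>t. eval_fps ?F t / t) (of_real t))"
  proof (rule primitive_polylog[OF J])
    show "J \<noteq> []" by (simp add: J_def)
    fix t :: complex assume t: "norm t < 1" "t \<noteq> 0"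
    have "fps_X * fps_deriv ?G = ?F"
      by (rule fps_ext) (auto simp: I J_def fps_X_mult_nth field_simps)
    moreover have "norm t < fps_conv_radius (fps_deriv ?G)"
      using one_le_conv_radius_polylog[OF J] fps_conv_radius_deriv[of ?G] t
      by (metis ereal_less(3) order_less_le_trans)
    ultimately have "eval_fps ?F t = t * eval_fps (fps_deriv ?G) t"
      using eval_fps_mult[of t fps_X "fps_deriv ?G"] by simp
    then show "eval_fps (fps_deriv ?G) t = eval_fps ?F t / t"
      using t by simp
  qed
  then show ?thesis using J that by (simp add: polylog_def)
qed

text \<open>The effect on indices of the substitution of \<open>c * t\<close> for \<open>t\<close>:
  the coefficient of \<open>t ^ m\<close> is multiplied by \<open>c ^ m\<close>.\<close>

fun twist :: "complex \<Rightarrow> (nat \<times> complex) list \<Rightarrow> (nat \<times> complex) list" where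
  "twist c [] = []"
| "twist c ((a, z) # I) = (a, c * z) # I"

lemma cmzv_coeff_twist: "cmzv_coeff (twist c I) m = c ^ m * cmzv_coeff I m"
  by (cases "(c, I)" rule: twist.cases) (auto simp: power_mult_distrib)

lemma twist_level4_indices: "c ^ 4 = 1 \<Longrightarrow> I \<in> level4_indices n \<Longrightarrow> twist c I \<in> level4_indices n"
  by (cases "(c, I)" rule: twist.cases) (auto simp: level4_indices_def power_mult_distrib)

text \<open>Expanding \<open>1 / (a - t)\<close> geometrically, the product with the series of
  \<open>I\<close> has the coefficients
  \<open>(1 / a) ^ Suc m * (\<Sum>k\<le>m. a ^ k * cmzv_coeff I k)\<close>. The inner sum is the
  truncated sum of the twisted index, whence the new first pair \<open>(1, 1 / a)\<close>.\<close>

lemma primitive_polylog_at_root: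
  assumes "I \<in> level4_indices n" "a ^ 4 = 1"
  defines "J \<equiv> (1, 1 / a) # twist a I"
  shows "J \<in> level4_indices (Suc n)" "primitive (polylog J) (\<lambda>t. polylog I t / (a - of_real t))"
proof -
  have [simp]: "a \<noteq> 0" using assms by auto
  show J: "J \<in> level4_indices (Suc n)"
    using twist_level4_indices[OF assms(2,1)] assms(2)
    by (auto simp: J_def level4_indices_def power_divide)
  let ?F = "Abs_fps (cmzv_coeff I)" and ?G = "Abs_fps (cmzv_coeff J)"
  have "primitive (polylog J) (\<lambda>t. (\<lambda>t. eval_fps ?F t / (a - t)) (of_real t))"
  proof (rule primitive_polylog[OF J])
    show "J \<noteq> []" by (simp add: J_def)
    fix t :: complex assume t: "norm t < 1"
    have D: "fps_nth (fps_deriv ?G) m = (1 / a) ^ Suc m * (\<Sum>k\<le>m. a ^ k * cmzv_coeff I k)" for m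
      by (simp add: J_def cmzv_trunc_eq_sum_coeff cmzv_coeff_twist del: of_nat_Suc)
    have "(fps_const a - fps_X) * fps_deriv ?G = ?F"
    proof (rule fps_ext)
      fix m
      show "fps_nth ((fps_const a - fps_X) * fps_deriv ?G) m = fps_nth ?F m"
        unfolding left_diff_distrib fps_sub_nth fps_mult_left_const_nth fps_X_mult_nth D
        by (cases m) (auto simp: power_divide D field_simps simp del: fps_deriv_nth)
    qed
    moreover have "norm t < fps_conv_radius (fps_deriv ?G)"
      using one_le_conv_radius_polylog[OF J] fps_conv_radius_deriv[of ?G] t
      by (metis ereal_less(3) order_less_le_trans)
    moreover have "norm t < fps_conv_radius (fps_const a - fps_X)"
      using fps_conv_radius_diff[of "fps_const a" fps_X] by auto
    ultimately have "eval_fps ?F t = (a - t) * eval_fps (fps_deriv ?G) t"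
      using eval_fps_mult[of t "fps_const a - fps_X" "fps_deriv ?G"] by (simp add: eval_fps_diff)
    moreover have "a - t \<noteq> 0"
      using t norm_fourth_root[OF assms(2)] by auto
    ultimately show "eval_fps (fps_deriv ?G) t = eval_fps ?F t / (a - t)"
      by simp
  qed
  then show "primitive (polylog J) (\<lambda>t. polylog I t / (a - of_real t))"
    by (simp add: polylog_def)
qed

text \<open>The coefficients are \<open>z ^ n * b n\<close> with \<open>b n = c (n - 1) / n\<close>,
  where \<open>c\<close> is the truncated sum of \<open>K\<close>. Since \<open>c\<close> is
  O(\<open>sqrt n\<close>) and its increments are O(\<open>1 / sqrt n\<close>), \<open>b\<close>
  tends to 0 with increments O(\<open>n powr (-3/2)\<close>), so
  \<open>abel_bounded_variation\<close> applies.\<close>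

lemma tendsto_polylog_at_left_1:
  assumes "(1, z) # K \<in> level4_indices n" "z \<noteq> 1"
  obtains x where "x \<in> CMZV 4 n" "(polylog ((1, z) # K) \<longlongrightarrow> x) (at_left 1)"
proof -
  have z: "z ^ 4 = 1" and K: "\<forall>(a, z) \<in> set K. a \<ge> 1 \<and> z ^ 4 = 1"
    using assms by (auto simp: level4_indices_def)
  define B :: real where "B = 2 ^ length K"
  define c where "c = cmzv_trunc K"
  have c: "norm (c m) \<le> B * sqrt (real (Suc m))" for m
    using norm_cmzv_trunc_le[OF K] by (simp add: B_def c_def)
  have dc: "norm (c (Suc m) - c m) \<le> B / sqrt (real (Suc m))" for m
  proof (cases K)
    case Nil
    then show ?thesis by (simp add: c_def B_def)
  next
    case (Cons x L)
    obtain a y where x: "x = (a, y)" by (cases x)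
    have "norm (c (Suc m) - c m) = norm (y ^ Suc m / of_nat (Suc m) ^ a * cmzv_trunc L m)"
      by (simp add: c_def Cons x cmzv_trunc_Cons_Suc)
    also have "\<dots> \<le> 2 ^ length L / sqrt (real (Suc m))"
      using K norm_cmzv_trunc_le[of L m] by (intro norm_cmzv_term_le) (auto simp: Cons x)
    also have "\<dots> \<le> B / sqrt (real (Suc m))"
      by (intro divide_right_mono) (auto simp: B_def Cons)
    finally show ?thesis .
  qed
  define b where "b n = (if n = 0 then 0 else c (n - 1) / of_nat n)" for n
  have norm_b: "norm (b (Suc m)) \<le> B / sqrt (real (Suc m))" for m
    using norm_cmzv_term_le[of 1 1 "c m" B m] c[of m] by (simp add: b_def)
  have "(\<lambda>m. B / sqrt (real (Suc m))) \<longlonglongrightarrow> 0"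
    by real_asymp
  then have "(\<lambda>m. b (Suc m)) \<longlonglongrightarrow> 0"
    by (rule Lim_null_comparison[rotated]) (use norm_b in auto)
  then have b0: "b \<longlonglongrightarrow> 0" by (simp add: filterlim_sequentially_Suc)
  have bv: "norm (b (Suc (Suc m)) - b (Suc m)) \<le> 2 * B * real (Suc m) powr (-3/2)" for m
  proof -
    define u where "u = real (Suc m)"
    have u: "u \<ge> 1" "of_nat (Suc m) = complex_of_real u" "of_nat (Suc (Suc m)) = complex_of_real (u + 1)"
      by (auto simp: u_def)
    have "b (Suc (Suc m)) - b (Suc m) = (c (Suc m) - c m) / of_real (u + 1) - c m / of_real (u * (u + 1))"
    proof -
      have "b (Suc (Suc m)) = c (Suc m) / of_real (u + 1)" "b (Suc m) = c m / of_real u"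
        by (simp_all add: b_def u_def)
      moreover have "c m / complex_of_real u = c m / of_real (u + 1) + c m / of_real (u * (u + 1))"
      proof -
        have "complex_of_real u \<noteq> 0" "complex_of_real u + 1 \<noteq> 0"
          using u by (auto simp: complex_eq_iff)
        then show ?thesis by (simp add: divide_simps) (simp add: algebra_simps)
      qed
      ultimately show ?thesis by (simp add: diff_divide_distrib)
    qed
    also have "norm \<dots> \<le> norm (c (Suc m) - c m) / (u + 1) + norm (c m) / (u * (u + 1))"
      using u(1) norm_triangle_ineq4[of "(c (Suc m) - c m) / of_real (u + 1)" "c m / of_real (u * (u + 1))"]
      by (simp only: norm_divide norm_of_real) simp
    also have "\<dots> \<le> (B / sqrt u) / u + (B * sqrt u) / (u * u)"
      using u(1) dc[of m] c[of m]
      by (intro add_mono frac_le mult_left_mono) (auto simp: u_def B_def)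
    also have "\<dots> = 2 * B * u powr (-3/2)"
    proof -
      have "u powr (-3/2) = 1 / (u * sqrt u)"
        using u(1) powr_add[of u 1 "1/2"] by (simp add: powr_minus_divide powr_half_sqrt)
      moreover have "sqrt u / (u * u) = 1 / (u * sqrt u)"
        using u(1) by (simp add: field_simps)
      moreover have "B / sqrt u / u + B * sqrt u / (u * u) = B * (1 / (u * sqrt u)) + B * (sqrt u / (u * u))"
        by (simp add: mult.commute)
      ultimately show ?thesis by simp
    qed
    finally show ?thesis by (simp add: u_def)
  qed
  have "summable (\<lambda>m. 2 * B * real (Suc m) powr (-3/2))"
    by (intro summable_mult) (subst summable_Suc_iff, simp add: summable_real_powr_iff)
  then have "summable (\<lambda>m. norm (b (Suc (Suc m)) - b (Suc m)))"
    by (rule summable_comparison_test'[where N = 0]) (use bv in auto)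
  then have "summable (\<lambda>m. norm (b (Suc m) - b m))"
    by (subst summable_Suc_iff[symmetric])
  then obtain x where x: "(\<lambda>N. \<Sum>n\<le>N. z ^ n * b n) \<longlonglongrightarrow> x"
    "((\<lambda>t. \<Sum>n. z ^ n * b n * of_real t ^ n) \<longlongrightarrow> x) (at_left (1::real))"
    using abel_bounded_variation[OF norm_fourth_root[OF z] assms(2) b0] by (auto simp: b_def)
  have coeff: "cmzv_coeff ((1, z) # K) = (\<lambda>n. z ^ n * b n)"
    by (auto simp: b_def c_def)
  interpret Q: vector_space rat_scale by (rule vector_space_rat_scale)
  have "(1, z) # K \<in> cmzv_indices 4 n"
    using assms by (auto simp: cmzv_indices_def level4_indices_def)
  moreover have "cmzv_trunc ((1, z) # K) \<longlonglongrightarrow> x"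
    using x(1) by (simp only: cmzv_trunc_eq_sum_coeff[abs_def] coeff)
  ultimately have "x \<in> CMZV 4 n"
    unfolding CMZV_def by (intro Q.span_base) auto
  moreover have "(polylog ((1, z) # K) \<longlongrightarrow> x) (at_left 1)"
    using x(2) unfolding polylog_def[abs_def] eval_fps_def coeff by simp
  ultimately show ?thesis by (rule that)
qed

text \<open>Rational span of the polylogarithms of one weight, as functions on
  \<open>{0..<1}\<close> only. The inductive form lets primitives and limits at 1 be built along the
  linear combination.\<close>

inductive polylog_span :: "nat \<Rightarrow> (real \<Rightarrow> complex) \<Rightarrow> bool" where
  base: "I \<in> level4_indices n \<Longrightarrow> (\<And>t. t \<in> {0..<1} \<Longrightarrow> f t = polylog I t) \<Longrightarrow> polylog_span n f"
| lincomb: "polylog_span n f \<Longrightarrow> polylog_span n g \<Longrightarrow>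
    (\<And>t. t \<in> {0..<1} \<Longrightarrow> h t = of_rat q * f t + of_rat r * g t) \<Longrightarrow> polylog_span n h"

lemma polylog_span_cong:
  "polylog_span n f \<Longrightarrow> (\<And>t. t \<in> {0..<1} \<Longrightarrow> g t = f t) \<Longrightarrow> polylog_span n g"
  by (rule lincomb[where q = 1 and r = 0 and f = f and g = f]) auto

lemma polylog_span_primitive_at_0:
  assumes "polylog_span n f" "n > 0"
  shows "\<exists>h. polylog_span (Suc n) h \<and> primitive h (\<lambda>t. f t / of_real t)"
  using assms
proof induction
  case (base I n f)
  from primitive_polylog_at_0[OF base(1,3)] obtain J where
    J: "J \<in> level4_indices (Suc n)" "primitive (polylog J) (\<lambda>t. polylog I t / of_real t)" .
  moreover have "polylog_span (Suc n) (polylog J)"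
    using J(1) by (blast intro: polylog_span.base)
  moreover have "primitive (polylog J) (\<lambda>t. f t / of_real t)"
    by (rule primitive_cong[OF J(2)]) (auto simp: base)
  ultimately show ?case by blast
next
  case (lincomb n f g h q r)
  then obtain F G where FG: "polylog_span (Suc n) F" "polylog_span (Suc n) G"
    "primitive F (\<lambda>t. f t / of_real t)" "primitive G (\<lambda>t. g t / of_real t)" by auto
  show ?case
  proof (intro exI conjI)
    show "polylog_span (Suc n) (\<lambda>t. of_rat q * F t + of_rat r * G t)"
      by (rule polylog_span.lincomb[OF FG(1,2)]) auto
    show "primitive (\<lambda>t. of_rat q * F t + of_rat r * G t) (\<lambda>t. h t / of_real t)"
      by (rule primitive_cong[OF primitive_add[OF primitive_cmult[OF FG(3)] primitive_cmult[OF FG(4)]]])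
         (auto simp: lincomb add_divide_distrib)
  qed
qed

text \<open>The limit at 1 is carried through the same induction. In the base case the primitive
  starts with \<open>(1, 1 / a)\<close>, which converges at 1 as soon as
  \<open>a \<noteq> 1\<close>.\<close>

lemma polylog_span_primitive_at_root:
  assumes "polylog_span n f" "a ^ 4 = 1"
  shows "\<exists>h. polylog_span (Suc n) h \<and> primitive h (\<lambda>t. f t / (a - of_real t)) \<and>
    (a \<noteq> 1 \<longrightarrow> (\<exists>x \<in> CMZV 4 (Suc n). (h \<longlongrightarrow> x) (at_left 1)))"
  using assms
proof induction
  case (base I n f)
  let ?J = "(1, 1 / a) # twist a I"
  have J: "?J \<in> level4_indices (Suc n)" "primitive (polylog ?J) (\<lambda>t. polylog I t / (a - of_real t))"
    using primitive_polylog_at_root base by auto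
  have "\<exists>x\<in>CMZV 4 (Suc n). (polylog ?J \<longlongrightarrow> x) (at_left 1)" if "a \<noteq> 1"
    by (rule tendsto_polylog_at_left_1[OF J(1)]) (use that base in auto)
  moreover have "polylog_span (Suc n) (polylog ?J)"
    using J(1) by (blast intro: polylog_span.base)
  moreover have "primitive (polylog ?J) (\<lambda>t. f t / (a - of_real t))"
    by (rule primitive_cong[OF J(2)]) (auto simp: base)
  ultimately show ?case by blast
next
  case (lincomb n f g h q r)
  then obtain F G where FG: "polylog_span (Suc n) F" "polylog_span (Suc n) G"
    "primitive F (\<lambda>t. f t / (a - of_real t))" "primitive G (\<lambda>t. g t / (a - of_real t))"
    "a \<noteq> 1 \<Longrightarrow> (\<exists>x \<in> CMZV 4 (Suc n). (F \<longlongrightarrow> x) (at_left 1))"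
    "a \<noteq> 1 \<Longrightarrow> (\<exists>x \<in> CMZV 4 (Suc n). (G \<longlongrightarrow> x) (at_left 1))" by auto
  interpret Q: vector_space rat_scale by (rule vector_space_rat_scale)
  show ?case
  proof (intro exI conjI impI)
    show "polylog_span (Suc n) (\<lambda>t. of_rat q * F t + of_rat r * G t)"
      by (rule polylog_span.lincomb[OF FG(1,2)]) auto
    show "primitive (\<lambda>t. of_rat q * F t + of_rat r * G t) (\<lambda>t. h t / (a - of_real t))"
      by (rule primitive_cong[OF primitive_add[OF primitive_cmult[OF FG(3)] primitive_cmult[OF FG(4)]]])
         (auto simp: lincomb add_divide_distrib)
    assume "a \<noteq> 1"
    then obtain x y where "x \<in> CMZV 4 (Suc n)" "y \<in> CMZV 4 (Suc n)" and
      xy: "(F \<longlongrightarrow> x) (at_left 1)" "(G \<longlongrightarrow> y) (at_left 1)"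
      using FG by blast
    then have "of_rat q * x + of_rat r * y \<in> CMZV 4 (Suc n)"
      unfolding CMZV_def by (intro Q.span_add Q.span_scale)
    moreover have "((\<lambda>t. of_rat q * F t + of_rat r * G t) \<longlongrightarrow> of_rat q * x + of_rat r * y) (at_left 1)"
      by (intro tendsto_intros xy)
    ultimately show "\<exists>x \<in> CMZV 4 (Suc n). ((\<lambda>t. of_rat q * F t + of_rat r * G t) \<longlongrightarrow> x) (at_left 1)"
      by blast
  qed
qed

section \<open>Logarithmic forms\<close>

lemma polylog_span_add:
  "polylog_span n f \<Longrightarrow> polylog_span n g \<Longrightarrow> polylog_span n (\<lambda>t. f t + g t)"
  by (rule polylog_span.lincomb[where q = 1 and r = 1]) auto

lemma polylog_span_cmult:
  "polylog_span n f \<Longrightarrow> polylog_span n (\<lambda>t. of_rat q * f t)"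
  by (rule polylog_span.lincomb[where q = q and r = 0 and f = f and g = f]) auto

text \<open>The flag says whether a pole at 0 is allowed; it has to be excluded for constant functions,
  i.e. in weight 0.\<close>

definition log_form :: "bool \<Rightarrow> (real \<Rightarrow> complex) \<Rightarrow> bool" where
  "log_form pole \<phi> \<longleftrightarrow> (\<exists>q0 q1 q2 q3 q4. (pole \<or> q0 = 0) \<and> (\<forall>t\<in>{0<..<1}.
     \<phi> t = of_rat q0 / of_real t + of_rat q1 / (1 - of_real t) + of_rat q2 / (- 1 - of_real t) +
       of_rat q3 / (\<i> - of_real t) + of_rat q4 / (- \<i> - of_real t)))"

lemma polylog_span_ex_primitive:
  assumes f: "polylog_span n f" and "log_form (n > 0) \<phi>"
  shows "\<exists>h. polylog_span (Suc n) h \<and> primitive h (\<lambda>t. \<phi> t * f t)"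
proof -
  obtain q0 q1 q2 q3 q4 where q0: "n > 0 \<or> q0 = 0" and \<phi>: "\<And>t. t \<in> {0<..<1} \<Longrightarrow>
     \<phi> t = of_rat q0 / of_real t + of_rat q1 / (1 - of_real t) + of_rat q2 / (- 1 - of_real t) +
       of_rat q3 / (\<i> - of_real t) + of_rat q4 / (- \<i> - of_real t)"
    using assms(2) unfolding log_form_def by blast
  obtain h1 where h1: "polylog_span (Suc n) h1" "primitive h1 (\<lambda>t. f t / (1 - of_real t))"
    using polylog_span_primitive_at_root[OF f, of 1] by auto
  obtain h2 where h2: "polylog_span (Suc n) h2" "primitive h2 (\<lambda>t. f t / (- 1 - of_real t))"
    using polylog_span_primitive_at_root[OF f, of "- 1"] by auto
  obtain h3 where h3: "polylog_span (Suc n) h3" "primitive h3 (\<lambda>t. f t / (\<i> - of_real t))"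
    using polylog_span_primitive_at_root[OF f, of \<i>] by auto
  obtain h4 where h4: "polylog_span (Suc n) h4" "primitive h4 (\<lambda>t. f t / (- \<i> - of_real t))"
    using polylog_span_primitive_at_root[OF f, of "- \<i>"] by auto
  \<comment> \<open>If \<open>q0 = 0\<close>, then \<open>h1\<close> and its integrand stand in for
    \<open>h0\<close> and \<open>g0\<close>, since both sides of the last equation vanish. Otherwise
    the weight is positive and a primitive for \<open>dt / t\<close> exists.\<close>
  obtain h0 g0 where h0: "polylog_span (Suc n) h0" "primitive h0 g0"
    "\<And>t. of_rat q0 * g0 t = of_rat q0 * f t / of_real t"
    using q0 polylog_span_primitive_at_0[OF f] h1 by (cases "q0 = 0") auto
  let ?h = "\<lambda>t. of_rat q0 * h0 t + (of_rat q1 * h1 t + (of_rat q2 * h2 t +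
    (of_rat q3 * h3 t + of_rat q4 * h4 t)))"
  have "polylog_span (Suc n) ?h"
    by (intro polylog_span_add polylog_span_cmult h0 h1 h2 h3 h4)
  moreover have "primitive ?h (\<lambda>t. \<phi> t * f t)"
    by (rule primitive_cong[OF primitive_add[OF primitive_cmult[OF h0(2)]
          primitive_add[OF primitive_cmult[OF h1(2)] primitive_add[OF primitive_cmult[OF h2(2)]
          primitive_add[OF primitive_cmult[OF h3(2)] primitive_cmult[OF h4(2)]]]]]])
       (simp add: \<phi> h0(3) distrib_right)
  ultimately show ?thesis by blast
qed

text \<open>Any primitive agrees on \<open>{0..<1}\<close> with the constructed one, and membership
  in the span depends only on the values there.\<close>

lemma polylog_span_primitive:
  assumes "primitive h (\<lambda>t. \<phi> t * f t)" "polylog_span n f" "log_form (n > 0) \<phi>"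
  shows "polylog_span (Suc n) h"
proof -
  obtain k where k: "polylog_span (Suc n) k" "primitive k (\<lambda>t. \<phi> t * f t)"
    using polylog_span_ex_primitive assms by blast
  show ?thesis
    by (rule polylog_span_cong[OF k(1)]) (rule primitive_unique[OF assms(1) k(2)])
qed

lemma polylog_span_primitive_add:
  assumes "primitive h (\<lambda>t. \<phi> t * f t + \<psi> t * g t)"
    and "polylog_span n f" "log_form (n > 0) \<phi>" "polylog_span n g" "log_form (n > 0) \<psi>"
  shows "polylog_span (Suc n) h"
proof -
  obtain k where k: "polylog_span (Suc n) k" "primitive k (\<lambda>t. \<phi> t * f t)"
    using polylog_span_ex_primitive assms by blast
  obtain l where l: "polylog_span (Suc n) l" "primitive l (\<lambda>t. \<psi> t * g t)"
    using polylog_span_ex_primitive assms by blast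
  show ?thesis
    by (rule polylog_span_cong[OF polylog_span_add[OF k(1) l(1)]])
       (rule primitive_unique[OF assms(1) primitive_add[OF k(2) l(2)]])
qed

text \<open>Trigonometric functions of \<open>2 * arctan t\<close>, and the derivative of that angle.\<close>

definition sn :: "real \<Rightarrow> real" where "sn t = 2 * t / (1 + t\<^sup>2)"
definition cs :: "real \<Rightarrow> real" where "cs t = (1 - t\<^sup>2) / (1 + t\<^sup>2)"
definition dang :: "real \<Rightarrow> real" where "dang t = 2 / (1 + t\<^sup>2)"
definition lsec :: "real \<Rightarrow> real" where "lsec t = - ln (cs t)"

lemma one_plus_square_neq_0 [simp]: "1 + t\<^sup>2 \<noteq> (0::real)"
  by (metis add_pos_nonneg less_irrefl zero_le_power2 zero_less_one)

lemma sn_0 [simp]: "sn 0 = 0" and cs_0 [simp]: "cs 0 = 1" and lsec_0 [simp]: "lsec 0 = 0"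
  by (simp_all add: sn_def cs_def lsec_def)

lemma sn_sq_plus_cs_sq: "(sn t)\<^sup>2 + (cs t)\<^sup>2 = 1"
  unfolding sn_def cs_def power_divide add_divide_distrib[symmetric]
  by (simp add: divide_eq_eq) (simp add: power2_eq_square algebra_simps)

lemma cs_pos: "t \<in> {0..<1} \<Longrightarrow> cs t > 0"
  by (auto simp: cs_def abs_square_less_1 intro!: divide_pos_pos add_pos_nonneg)

lemma dang_pos: "dang t > 0"
  by (auto simp: dang_def intro!: divide_pos_pos add_pos_nonneg)

lemma sn_nonneg: "t \<ge> 0 \<Longrightarrow> sn t \<ge> 0" 
  by (auto simp: sn_def)

lemma sn_pos: "t > 0 \<Longrightarrow> sn t > 0"
  by (auto simp: sn_def intro!: divide_pos_pos add_pos_nonneg)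

lemma sn_sq_less_1: "t \<in> {0..<1} \<Longrightarrow> (sn t)\<^sup>2 < 1"
  using sn_sq_plus_cs_sq[of t] zero_less_power[OF cs_pos[of t], of 2] by linarith

lemma lsec_nonneg: "t \<in> {0..<1} \<Longrightarrow> lsec t \<ge> 0"
  using cs_pos[of t] sn_sq_plus_cs_sq[of t]
  by (auto simp: lsec_def ln_le_zero_iff) (metis abs_le_square_iff abs_of_pos add.commute le_add_same_cancel1 abs_one one_power2 zero_le_power2 abs_square_le_1)

lemma dang_div_sn: "dang t / sn t = 1 / t"
proof -
  have "sn t = t * dang t" by (simp add: sn_def dang_def)
  then show ?thesis using dang_pos[of t] by simp
qed

lemma has_real_derivative_sn: "(sn has_real_derivative cs t * dang t) (at t)"
  unfolding sn_def[abs_def] cs_def dang_def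
  by (auto intro!: derivative_eq_intros simp: divide_simps) (simp add: power2_eq_square algebra_simps)

lemma has_real_derivative_cs: "(cs has_real_derivative - (sn t * dang t)) (at t)"
  unfolding cs_def[abs_def] sn_def dang_def
  by (auto intro!: derivative_eq_intros simp: divide_simps) (simp add: power2_eq_square algebra_simps)

lemma has_real_derivative_lsec:
  "t \<in> {0..<1} \<Longrightarrow> (lsec has_real_derivative sn t * dang t / cs t) (at t)"
  unfolding lsec_def[abs_def] using cs_pos[of t]
  by (auto intro!: derivative_eq_intros has_real_derivative_cs simp: divide_simps)

lemma has_real_derivative_lsec_power:
  assumes "t \<in> {0..<1}"
  shows "((\<lambda>t. lsec t ^ Suc k / fact (Suc k)) has_real_derivative
    lsec t ^ k / fact k * (sn t * dang t / cs t)) (at t)"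
  using DERIV_cdivide[OF DERIV_power[OF has_real_derivative_lsec[OF assms], of "Suc k"], of "fact (Suc k)"]
  by (simp add: fact_Suc field_simps del: of_nat_Suc)

lemma continuous_on_lsec [continuous_intros]: "continuous_on {0..<1} lsec"
  by (intro continuous_at_imp_continuous_on ballI DERIV_isCont[OF has_real_derivative_lsec])

section \<open>Partial fractions of the angular forms\<close>

lemma log_form_denominators:
  "\<i> - of_real t \<noteq> 0" "- \<i> - of_real t \<noteq> 0" "1 + (of_real t)\<^sup>2 \<noteq> (0::complex)"
proof -
  show "1 + (of_real t)\<^sup>2 \<noteq> (0::complex)"
    by (metis of_real_1 of_real_add of_real_power of_real_eq_0_iff one_plus_square_neq_0)
qed (auto simp: complex_eq_iff)

text \<open>The residues of \<open>2 / (1 + t\<^sup>2)\<close> at \<open>\<plusminus>\<i>\<close>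
  are imaginary; the factor \<open>\<i>\<close> makes the coefficients rational.\<close>

lemma log_form_dang: "log_form pole (\<lambda>t. \<i> * of_real (dang t))"
  unfolding log_form_def
proof (intro exI conjI ballI)
  fix t :: real
  note log_form_denominators[of t]
  then show "\<i> * of_real (dang t) = of_rat 0 / of_real t + of_rat 0 / (1 - of_real t) +
     of_rat 0 / (- 1 - of_real t) + of_rat (- 1) / (\<i> - of_real t) + of_rat 1 / (- \<i> - of_real t)"
    by (simp add: dang_def divide_simps) (simp add: power2_eq_square algebra_simps)
qed auto

text \<open>In terms of the angle this is \<open>d\<theta> / sin \<theta>\<close>, by
  \<open>dang_div_sn\<close>.\<close>

lemma log_form_inverse: "log_form True (\<lambda>t. 1 / of_real t)"
  unfolding log_form_def
  by (rule exI[of _ 1], (rule exI[of _ 0])+) auto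

lemma log_form_cot: "log_form True (\<lambda>t. of_real (cs t * dang t / sn t))"
  unfolding log_form_def
proof (intro exI conjI ballI)
  fix t :: real assume t: "t \<in> {0<..<1}"
  note log_form_denominators[of t]
  moreover have "cs t * dang t / sn t = (1 - t\<^sup>2) / ((1 + t\<^sup>2) * t)"
    by (metis cs_def dang_div_sn divide_divide_eq_left times_divide_eq_right mult_1_right)
  then have "complex_of_real (cs t * dang t / sn t) =
      (1 - (of_real t)\<^sup>2) / ((1 + (of_real t)\<^sup>2) * of_real t)"
    by simp
  ultimately show "of_real (cs t * dang t / sn t) = of_rat 1 / of_real t + of_rat 0 / (1 - of_real t) +
     of_rat 0 / (- 1 - of_real t) + of_rat 1 / (\<i> - of_real t) + of_rat 1 / (- \<i> - of_real t)"
    using t by (simp only:) (simp add: divide_simps, simp add: power2_eq_square algebra_simps)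
qed auto

text \<open>This form is the differential of \<open>lsec\<close>. It is regular at 0, so it may be
  integrated against constants, which \<open>log_span_one\<close> relies on.\<close>

lemma log_form_tan: "log_form pole (\<lambda>t. of_real (sn t * dang t / cs t))"
  unfolding log_form_def
proof (intro exI conjI ballI)
  fix t :: real assume t: "t \<in> {0<..<1}"
  have nz: "\<i> - of_real t \<noteq> 0" "- \<i> - of_real t \<noteq> 0" "1 + (of_real t)\<^sup>2 \<noteq> (0::complex)"
    "1 - of_real t \<noteq> (0::complex)" "- 1 - of_real t \<noteq> (0::complex)"
    using t log_form_denominators[of t] by (auto simp: complex_eq_iff)
  have "sn t * dang t / cs t = 2 * t / (1 + t\<^sup>2) + 1 / (1 - t) + 1 / (- 1 - t)"
  proof -
    have "1 - t\<^sup>2 \<noteq> 0" "1 - t \<noteq> 0" "- 1 - t \<noteq> 0"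
      using t by (auto simp: power2_eq_1_iff)
    then show ?thesis
      by (simp add: sn_def cs_def dang_def divide_simps) (simp add: power2_eq_square algebra_simps)
  qed
  moreover have "2 * of_real t / (1 + (of_real t)\<^sup>2) = - 1 / (\<i> - of_real t) + - 1 / (- \<i> - of_real t)"
    using nz by (simp add: divide_simps) (simp add: power2_eq_square algebra_simps)
  ultimately show "of_real (sn t * dang t / cs t) = of_rat 0 / of_real t + of_rat 1 / (1 - of_real t) +
     of_rat 1 / (- 1 - of_real t) + of_rat (- 1) / (\<i> - of_real t) + of_rat (- 1) / (- \<i> - of_real t)"
    by simp
qed auto

text \<open>Products with powers of the logarithm replace the shuffle product of iterated integrals.\<close>

definition log_span :: "nat \<Rightarrow> (real \<Rightarrow> complex) \<Rightarrow> bool" where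
  "log_span n f \<longleftrightarrow> (\<forall>k. polylog_span (n + k) (\<lambda>t. of_real (lsec t ^ k / fact k) * f t))"

lemma log_span_cmult: "log_span n f \<Longrightarrow> log_span n (\<lambda>t. of_rat q * f t)"
  unfolding log_span_def
proof
  fix k assume "\<forall>k. polylog_span (n + k) (\<lambda>t. of_real (lsec t ^ k / fact k) * f t)"
  then have "polylog_span (n + k) (\<lambda>t. of_rat q * (of_real (lsec t ^ k / fact k) * f t))"
    by (intro polylog_span_cmult) auto
  then show "polylog_span (n + k) (\<lambda>t. of_real (lsec t ^ k / fact k) * (of_rat q * f t))"
    by (simp only: mult_ac)
qed

text \<open>\<open>lsec t ^ k / fact k\<close> is the \<open>k\<close>-fold iterated integral of
  \<open>tan \<theta> d\<theta>\<close>.\<close>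

lemma log_span_one: "log_span 0 (\<lambda>t. 1)"
  unfolding log_span_def
proof
  fix k
  show "polylog_span (0 + k) (\<lambda>t. of_real (lsec t ^ k / fact k) * 1)"
  proof (induction k)
    case 0
    have "Abs_fps (cmzv_coeff []) = 1" by (rule fps_ext) simp
    then show ?case
      by (intro polylog_span.base[of "[]"]) (auto simp: level4_indices_def polylog_def)
  next
    case (Suc k)
    have "primitive (\<lambda>t. of_real (lsec t ^ Suc k / fact (Suc k)) * 1)
       (\<lambda>t. of_real (sn t * dang t / cs t) * (of_real (lsec t ^ k / fact k) * 1))"
      unfolding primitive_def
    proof (intro conjI ballI)
      fix t :: real assume "t \<in> {0<..<1}"
      then have "((\<lambda>t. of_real (lsec t ^ Suc k / fact (Suc k)) :: complex) has_vector_derivative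
         of_real (lsec t ^ k / fact k * (sn t * dang t / cs t))) (at t)"
        by (intro has_vector_derivative_of_real has_real_derivative_lsec_power) auto
      then show "((\<lambda>t. of_real (lsec t ^ Suc k / fact (Suc k)) * 1 :: complex) has_vector_derivative
         of_real (sn t * dang t / cs t) * (of_real (lsec t ^ k / fact k) * 1)) (at t)"
        by (simp only: mult_1_right mult_1_left of_real_mult mult_ac)
    qed (auto intro!: continuous_intros simp del: of_nat_Suc)
    from polylog_span_primitive[OF this Suc log_form_tan] show ?case by simp
  qed
qed

text \<open>By the product rule, the derivative of \<open>lsec ^ Suc k / fact (Suc k) * h\<close> is
  the tangent form times the same product for \<open>k\<close>, plus \<open>\<phi>\<close> times
  \<open>lsec ^ Suc k / fact (Suc k) * f\<close>. The first is covered by induction on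
  \<open>k\<close>, the second by the assumption on \<open>f\<close>.\<close>

lemma log_span_primitive:
  assumes f: "log_span n f" and \<phi>: "log_form (n > 0) \<phi>" and h: "primitive h (\<lambda>t. \<phi> t * f t)"
  shows "log_span (Suc n) h"
  unfolding log_span_def
proof
  fix k
  show "polylog_span (Suc n + k) (\<lambda>t. of_real (lsec t ^ k / fact k) * h t)"
  proof (induction k)
    case 0
    show ?case using polylog_span_primitive[OF h _ \<phi>] f[unfolded log_span_def, rule_format, of 0] by simp
  next
    case (Suc k)
    have \<phi>': "log_form (Suc n + k > 0) \<phi>"
      using \<phi> unfolding log_form_def by blast
    have "primitive (\<lambda>t. of_real (lsec t ^ Suc k / fact (Suc k)) * h t)
       (\<lambda>t. of_real (sn t * dang t / cs t) * (of_real (lsec t ^ k / fact k) * h t) +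
         \<phi> t * (of_real (lsec t ^ Suc k / fact (Suc k)) * f t))"
      unfolding primitive_def
    proof (intro conjI ballI)
      fix t :: real assume t: "t \<in> {0<..<1}"
      then have "((\<lambda>t. of_real (lsec t ^ Suc k / fact (Suc k)) :: complex) has_vector_derivative
         of_real (lsec t ^ k / fact k * (sn t * dang t / cs t))) (at t)"
        by (intro has_vector_derivative_of_real has_real_derivative_lsec_power) auto
      from has_vector_derivative_mult[OF this, of h "\<phi> t * f t"] h t
      show "((\<lambda>t. of_real (lsec t ^ Suc k / fact (Suc k)) * h t) has_vector_derivative
         of_real (sn t * dang t / cs t) * (of_real (lsec t ^ k / fact k) * h t) +
         \<phi> t * (of_real (lsec t ^ Suc k / fact (Suc k)) * f t)) (at t)"
        by (simp only: primitive_def of_real_mult mult_ac add.commute)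
    qed (use h in \<open>auto simp: primitive_def intro!: continuous_intros simp del: of_nat_Suc\<close>)
    from polylog_span_primitive_add[OF this Suc log_form_tan] f[unfolded log_span_def, rule_format, of "Suc k"] \<phi>'
    show ?case by simp
  qed
qed

text \<open>The form \<open>d\<theta>\<close> involves only the letters
  \<open>\<plusminus>\<i>\<close>. Both differ from 1, so both primitives have limits at 1 in the
  span of CMZVs.\<close>

lemma polylog_span_dang_limit:
  assumes "polylog_span n f"
  obtains h x where "primitive h (\<lambda>t. \<i> * of_real (dang t) * f t)" "x \<in> CMZV 4 (Suc n)"
    "(h \<longlongrightarrow> x) (at_left 1)"
proof -
  interpret Q: vector_space rat_scale by (rule vector_space_rat_scale)
  have "\<i> \<noteq> 1" "- \<i> \<noteq> 1" by (auto simp: complex_eq_iff)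
  then obtain g h x y where
    g: "primitive g (\<lambda>t. f t / (\<i> - of_real t))" "x \<in> CMZV 4 (Suc n)" "(g \<longlongrightarrow> x) (at_left 1)" and
    h: "primitive h (\<lambda>t. f t / (- \<i> - of_real t))" "y \<in> CMZV 4 (Suc n)" "(h \<longlongrightarrow> y) (at_left 1)"
    using polylog_span_primitive_at_root[OF assms, of \<i>] polylog_span_primitive_at_root[OF assms, of "- \<i>"]
    by auto
  show ?thesis
  proof
    show "((\<lambda>t. h t + (- 1) * g t) \<longlongrightarrow> y - x) (at_left 1)"
      by (auto intro!: tendsto_intros g h)
    show "y - x \<in> CMZV 4 (Suc n)"
      using g h unfolding CMZV_def by (intro Q.span_diff)
    show "primitive (\<lambda>t. h t + (- 1) * g t) (\<lambda>t. \<i> * of_real (dang t) * f t)"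
    proof (rule primitive_cong[OF primitive_add[OF h(1) primitive_cmult[OF g(1)]]])
      fix t :: real
      have "\<i> * of_real (dang t) = 1 / (- \<i> - of_real t) - 1 / (\<i> - of_real t)"
        using log_form_denominators[of t]
        by (simp add: dang_def divide_simps) (simp add: power2_eq_square algebra_simps)
      then show "f t / (- \<i> - of_real t) + - 1 * (f t / (\<i> - of_real t)) = \<i> * of_real (dang t) * f t"
        by (simp add: left_diff_distrib)
    qed
  qed
qed

section \<open>The power series in the squared sine\<close>

definition wallis :: "nat \<Rightarrow> real" where
  "wallis n = 4 ^ n / (real ((2 * n) choose n) * (2 * real n + 1))"

lemma wallis_0 [simp]: "wallis 0 = 1"
  by (simp add: wallis_def)

lemma wallis_eq_fact: "wallis n = 4 ^ n * (fact n)\<^sup>2 / fact (Suc (2 * n))"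
proof -
  have "real ((2 * n) choose n) = fact (2 * n) / (fact n * fact n)"
    by (subst binomial_fact) (auto simp: mult_2)
  then show ?thesis
    by (simp add: wallis_def power2_eq_square algebra_simps)
qed

lemma wallis_Suc: "wallis (Suc n) = wallis n * (2 * real n + 2) / (2 * real n + 3)"
proof -
  have f1: "fact (Suc (2 * Suc n)) = (2 * real n + 3) * ((2 * real n + 2) * fact (Suc (2 * n)))"
    by (simp add: fact_Suc[of "Suc (Suc (2 * n))"] fact_Suc[of "Suc (2 * n)"] del: fact_Suc)
       (simp add: algebra_simps)
  have f2: "(fact (Suc n) :: real)\<^sup>2 = (real n + 1)\<^sup>2 * (fact n)\<^sup>2"
    by (simp add: power_mult_distrib add.commute)
  have f3: "4 * (real n + 1)\<^sup>2 = (2 * real n + 2) * (2 * real n + 2)"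
    by (simp add: power2_eq_square algebra_simps)
  have "4 ^ Suc n * (fact (Suc n))\<^sup>2 = (4 * (real n + 1)\<^sup>2) * (4 ^ n * (fact n)\<^sup>2)"
    unfolding f2 power_Suc by (simp only: mult_ac)
  then have "wallis (Suc n) = (2 * real n + 2) * (2 * real n + 2) * (4 ^ n * (fact n)\<^sup>2) /
      ((2 * real n + 3) * ((2 * real n + 2) * fact (Suc (2 * n))))"
    unfolding wallis_eq_fact f1 f3[symmetric] by (simp only:)
  also have "\<dots> = (2 * real n + 2) / (2 * real n + 3) * (4 ^ n * (fact n)\<^sup>2 / fact (Suc (2 * n)))"
  proof -
    have "2 * real n + 2 \<noteq> 0" "2 * real n + 3 \<noteq> 0" by linarith+
    then show ?thesis by (simp add: mult.assoc del: fact_Suc)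
  qed
  finally show ?thesis by (simp add: wallis_eq_fact mult.commute del: fact_Suc)
qed

lemma wallis_nonneg: "wallis n \<ge> 0"
  by (simp add: wallis_def)

lemma wallis_le_1: "wallis n \<le> 1"
proof (induction n)
  case (Suc n)
  have "wallis n * ((2 * real n + 2) / (2 * real n + 3)) \<le> 1 * 1"
    using Suc by (intro mult_mono) auto
  then show ?case by (simp add: wallis_Suc)
qed simp

abbreviation (input) zeta2 :: "nat \<Rightarrow> nat \<Rightarrow> real" where
  "zeta2 p n \<equiv> zeta_trunc n (replicate p 2)"

lemma zeta2_Suc_Suc: "zeta2 (Suc p) (Suc n) = zeta2 (Suc p) n + zeta2 p n / real (Suc n) ^ 2"
  by (simp add: zeta_trunc_Cons_Suc)

lemma zeta2_nonneg: "zeta2 p n \<ge> 0"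
proof (induction n arbitrary: p)
  case 0
  show ?case by (cases p) auto
next
  case (Suc n)
  then show ?case by (cases p) (auto simp: zeta2_Suc_Suc simp del: replicate_Suc of_nat_Suc)
qed

lemma zeta2_le: "zeta2 p n \<le> real (Suc n)"
proof (induction n arbitrary: p)
  case 0
  show ?case by (cases p) auto
next
  case (Suc n)
  show ?case
  proof (cases p)
    case (Suc q)
    have "zeta2 q n / real (Suc n) ^ 2 \<le> real (Suc n) / real (Suc n) ^ 2"
      using Suc.IH by (intro divide_right_mono) auto
    also have "\<dots> \<le> 1"
      by (simp add: power2_eq_square)
    finally show ?thesis
      using Suc.IH[of "Suc q"] unfolding Suc zeta2_Suc_Suc by linarith
  qed simp
qed

text \<open>Series in \<open>u = (sin \<theta>)\<^sup>2\<close>. For \<open>j = 0\<close>, the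
  product of \<open>sin \<theta>\<close> and its value is \<open>4 ^ p * \<theta> ^ (2 * p + 1) /
  (fact (2 * p + 1) * cos \<theta>)\<close>.\<close>

definition S_series :: "nat \<Rightarrow> nat \<Rightarrow> real fps" where
  "S_series p j = Abs_fps (\<lambda>n. wallis n * zeta2 p n / (2 * real n + 1) ^ j)"

definition E_series :: "nat \<Rightarrow> real fps" where
  "E_series p = (case p of 0 \<Rightarrow> 1 | Suc q \<Rightarrow>
     Abs_fps (\<lambda>n. if n = 0 then 0 else 2 * (wallis (n - 1) * zeta2 q (n - 1)) / real n))"

lemma deriv_E_series: "fps_deriv (E_series (Suc p)) = 2 * S_series p 0"
  by (rule fps_ext) (simp add: E_series_def S_series_def numeral_fps_const del: of_nat_Suc)

text \<open>In \<open>u = (sin \<theta>)\<^sup>2\<close> this says that the angular derivative of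
  \<open>Y_fun p\<close> is \<open>E_fun p\<close>. On coefficients,
  \<open>(2 * n + 1) * wallis n = 2 * n * wallis (n - 1)\<close> leaves a multiple of
  \<open>zeta2 p n - zeta2 p (n - 1)\<close>, which the recursion of the zeta sums
  evaluates.\<close>

lemma E_series_eq:
  "E_series p = (1 - 2 * fps_X) * S_series p 0 + 2 * (fps_X * (1 - fps_X)) * fps_deriv (S_series p 0)"
  (is "_ = ?R")
proof -
  have R: "?R = S_series p 0 - fps_const 2 * (fps_X * S_series p 0) +
      fps_const 2 * (fps_X * fps_deriv (S_series p 0)) -
      fps_const 2 * (fps_X * (fps_X * fps_deriv (S_series p 0)))"
    by (simp add: numeral_fps_const algebra_simps)
  have "fps_nth (E_series p) n = fps_nth ?R n" for n
  proof (cases n)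
    case 0
    then show ?thesis unfolding R by (cases p) (auto simp: E_series_def S_series_def)
  next
    case (Suc m)
    have "fps_nth ?R n = (2 * real n + 1) * wallis n * zeta2 p n - 2 * real n * wallis m * zeta2 p m"
      unfolding R by (cases m) (auto simp: Suc S_series_def algebra_simps)
    also have "\<dots> = 2 * real n * wallis m * (zeta2 p n - zeta2 p m)"
      by (simp add: Suc wallis_Suc field_simps)
    also have "\<dots> = fps_nth (E_series p) n"
      by (cases p) (auto simp: Suc E_series_def zeta2_Suc_Suc power2_eq_square simp del: replicate_Suc of_nat_Suc)
    finally show ?thesis by simp
  qed
  then show ?thesis by (rule fps_ext)
qed

text \<open>The operator \<open>1 + 2 * u * d/du\<close> multiplies the coefficient of
  \<open>u ^ n\<close> by \<open>2 * n + 1\<close>.\<close>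

lemma S_series_Suc: "S_series p (Suc j) + 2 * fps_X * fps_deriv (S_series p (Suc j)) = S_series p j"
proof (rule fps_ext)
  fix n
  have "2 * fps_X * fps_deriv (S_series p (Suc j)) = fps_const 2 * (fps_X * fps_deriv (S_series p (Suc j)))"
    by (simp add: numeral_fps_const algebra_simps)
  moreover have "fps_nth (fps_X * fps_deriv (S_series p (Suc j))) n = real n * fps_nth (S_series p (Suc j)) n"
    by (cases n) auto
  ultimately have "fps_nth (S_series p (Suc j) + 2 * fps_X * fps_deriv (S_series p (Suc j))) n =
      (2 * real n + 1) * fps_nth (S_series p (Suc j)) n"
    by (simp only: fps_add_nth fps_mult_left_const_nth) (simp add: algebra_simps)
  moreover have "2 * real n + 1 \<noteq> 0" by linarith
  ultimately show "fps_nth (S_series p (Suc j) + 2 * fps_X * fps_deriv (S_series p (Suc j))) n = fps_nth (S_series p j) n"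
    by (simp only:) (simp add: S_series_def)
qed

lemma wallis_zeta2_le: "wallis n * zeta2 p n \<le> real (Suc n)"
  using mult_mono[OF wallis_le_1 zeta2_le zero_le_one zeta2_nonneg, of n n p] by simp

lemma one_le_conv_radius_S_series: "1 \<le> fps_conv_radius (S_series p j)"
proof (rule one_le_fps_conv_radius)
  fix n
  have "wallis n * zeta2 p n / (2 * real n + 1) ^ j \<le> real (Suc n) / 1"
    using wallis_zeta2_le by (intro frac_le) auto
  then show "norm (fps_nth (S_series p j) n) \<le> 1 * real (Suc n)"
    using wallis_nonneg[of n] zeta2_nonneg[of n p] by (simp add: S_series_def)
qed

lemma one_le_conv_radius_E_series: "1 \<le> fps_conv_radius (E_series p)"
proof (rule one_le_fps_conv_radius)
  fix n
  show "norm (fps_nth (E_series p) n) \<le> 2 * real (Suc n)"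
  proof (cases p)
    case (Suc q)
    have "2 * (wallis (n - 1) * zeta2 q (n - 1)) / real n \<le> 2 * real n / 1" if "n > 0"
      using wallis_zeta2_le[of "n - 1" q] that by (intro frac_le) auto
    then show ?thesis
      using wallis_nonneg[of "n - 1"] zeta2_nonneg[of "n - 1" q] by (auto simp: Suc E_series_def)
  qed (auto simp: E_series_def fps_one_nth)
qed

section \<open>Evaluation at the squared sine and differential equations\<close>

lemma less_one_conv_radius:
  fixes F :: "real fps"
  assumes "1 \<le> fps_conv_radius F" "t \<in> {0..<1}"
  shows "norm ((sn t)\<^sup>2) < fps_conv_radius F"
  using assms(1) sn_sq_less_1[OF assms(2)]
  by (metis abs_power2 ereal_less(3) order_less_le_trans real_norm_def)

lemma has_real_derivative_eval_sn_sq: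
  assumes "1 \<le> fps_conv_radius F" "t \<in> {0..<1}"
  shows "((\<lambda>t. eval_fps F ((sn t)\<^sup>2)) has_real_derivative
    eval_fps (fps_deriv F) ((sn t)\<^sup>2) * (2 * sn t * cs t * dang t)) (at t)"
proof -
  have "((\<lambda>t. (sn t)\<^sup>2) has_real_derivative 2 * sn t * cs t * dang t) (at t)"
    by (auto intro!: derivative_eq_intros has_real_derivative_sn)
  from DERIV_chain2[OF has_field_derivative_eval_fps[OF less_one_conv_radius[OF assms]] this]
  show ?thesis .
qed

lemma eval_E_series:
  assumes "t \<in> {0..<1}"
  shows "eval_fps (E_series p) ((sn t)\<^sup>2) =
    ((cs t)\<^sup>2 - (sn t)\<^sup>2) * eval_fps (S_series p 0) ((sn t)\<^sup>2) +
    2 * (sn t)\<^sup>2 * (cs t)\<^sup>2 * eval_fps (fps_deriv (S_series p 0)) ((sn t)\<^sup>2)"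
proof -
  let ?u = "(sn t)\<^sup>2" and ?S = "S_series p 0"
  have 1: "norm ?u < fps_conv_radius ?S"
    by (rule less_one_conv_radius[OF one_le_conv_radius_S_series assms])
  then have 2: "norm ?u < fps_conv_radius (fps_deriv ?S)"
    using fps_conv_radius_deriv[of ?S] by (rule order_less_le_trans)
  \<comment> \<open>As polynomials the two factors have infinite radius of convergence and evaluate
    by \<open>poly\<close>.\<close>
  have P: "fps_of_poly [:1, -2:] = (1 - 2 * fps_X :: real fps)"
    "fps_of_poly [:0, 2, -2:] = (2 * (fps_X * (1 - fps_X)) :: real fps)"
    by (simp_all add: fps_of_poly_pCons numeral_fps_const fps_const_neg[symmetric] algebra_simps del: fps_const_neg)
  have 3: "norm ?u < fps_conv_radius (fps_of_poly [:1, -2:] * ?S)"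
    "norm ?u < fps_conv_radius (fps_of_poly [:0, 2, -2:] * fps_deriv ?S)"
    using fps_conv_radius_mult[of "fps_of_poly [:1, -2:]" ?S]
      fps_conv_radius_mult[of "fps_of_poly [:0, 2, -2:]" "fps_deriv ?S"] 1 2
    by (auto simp: min_def intro: order_less_le_trans)
  have c: "(cs t)\<^sup>2 = 1 - ?u" using sn_sq_plus_cs_sq[of t] by simp
  show ?thesis
    unfolding E_series_eq P[symmetric] using 1 2 3
    by (simp add: eval_fps_add eval_fps_mult c) (simp add: algebra_simps)
qed

lemma eval_S_series_Suc:
  assumes "t \<in> {0..<1}"
  shows "eval_fps (S_series p (Suc j)) ((sn t)\<^sup>2) +
    2 * (sn t)\<^sup>2 * eval_fps (fps_deriv (S_series p (Suc j))) ((sn t)\<^sup>2) = eval_fps (S_series p j) ((sn t)\<^sup>2)"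
proof -
  let ?u = "(sn t)\<^sup>2" and ?S = "S_series p (Suc j)"
  have 1: "norm ?u < fps_conv_radius ?S"
    by (rule less_one_conv_radius[OF one_le_conv_radius_S_series assms])
  then have 2: "norm ?u < fps_conv_radius (fps_deriv ?S)"
    using fps_conv_radius_deriv[of ?S] by (rule order_less_le_trans)
  have P: "fps_of_poly [:0, 2:] = (2 * fps_X :: real fps)"
    by (simp add: fps_of_poly_pCons numeral_fps_const algebra_simps)
  have 3: "norm ?u < fps_conv_radius (fps_of_poly [:0, 2:] * fps_deriv ?S)"
    using fps_conv_radius_mult[of "fps_of_poly [:0, 2:]" "fps_deriv ?S"] 2
    by (auto intro: order_less_le_trans)
  have "eval_fps (S_series p j) ?u = eval_fps (?S + fps_of_poly [:0, 2:] * fps_deriv ?S) ?u"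
    by (simp add: P S_series_Suc)
  also have "\<dots> = eval_fps ?S ?u + 2 * ?u * eval_fps (fps_deriv ?S) ?u"
    using 1 2 3 by (simp add: eval_fps_add eval_fps_mult)
  finally show ?thesis by simp
qed

text \<open>With \<open>\<theta> = 2 * arctan t\<close>, this is
  \<open>(2 * \<theta>) ^ (2 * p) / fact (2 * p)\<close>, and \<open>Y_fun p\<close> is its
  primitive with respect to \<open>d\<theta>\<close>.\<close>

definition E_fun :: "nat \<Rightarrow> real \<Rightarrow> real" where
  "E_fun p t = eval_fps (E_series p) ((sn t)\<^sup>2)"

definition Y_fun :: "nat \<Rightarrow> real \<Rightarrow> real" where
  "Y_fun p t = cs t * (sn t * eval_fps (S_series p 0) ((sn t)\<^sup>2))"

definition S_fun :: "nat \<Rightarrow> nat \<Rightarrow> real \<Rightarrow> real" where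
  "S_fun p j t = sn t * eval_fps (S_series p j) ((sn t)\<^sup>2)"

lemma deriv_E_fun:
  assumes "t \<in> {0..<1}"
  shows "(E_fun (Suc p) has_real_derivative 4 * dang t * Y_fun p t) (at t)"
proof -
  have "norm ((sn t)\<^sup>2) < fps_conv_radius (S_series p 0)"
    by (rule less_one_conv_radius[OF one_le_conv_radius_S_series assms])
  then have "eval_fps (2 * S_series p 0) ((sn t)\<^sup>2) = 2 * eval_fps (S_series p 0) ((sn t)\<^sup>2)"
    by (subst eval_fps_mult) auto
  with has_real_derivative_eval_sn_sq[OF one_le_conv_radius_E_series assms, of "Suc p"]
  show ?thesis by (simp add: E_fun_def[abs_def] Y_fun_def deriv_E_series mult_ac)
qed

lemma deriv_Y_fun:
  assumes "t \<in> {0..<1}"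
  shows "(Y_fun p has_real_derivative dang t * E_fun p t) (at t)"
  unfolding Y_fun_def[abs_def] E_fun_def eval_E_series[OF assms]
  by (rule derivative_eq_intros has_real_derivative_cs has_real_derivative_sn
      has_real_derivative_eval_sn_sq[OF one_le_conv_radius_S_series assms] refl)+
     (simp add: power2_eq_square algebra_simps)

text \<open>The rule \<open>d S_fun p (Suc j) = cot \<theta> * S_fun p j * d\<theta>\<close> with
  the factor \<open>sn t\<close> cancelled, so that it also holds at \<open>t = 0\<close>.\<close>

lemma deriv_S_fun:
  assumes "t \<in> {0..<1}"
  shows "(S_fun p (Suc j) has_real_derivative cs t * dang t * eval_fps (S_series p j) ((sn t)\<^sup>2)) (at t)"
  unfolding S_fun_def[abs_def] eval_S_series_Suc[OF assms, of p j, symmetric]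
  by (rule derivative_eq_intros has_real_derivative_sn
      has_real_derivative_eval_sn_sq[OF one_le_conv_radius_S_series assms] refl)+
     (simp add: power2_eq_square algebra_simps)

lemma primitive_of_real:
  assumes "\<And>t. t \<in> {0..<1} \<Longrightarrow> (h has_real_derivative f t) (at t)" "h 0 = 0"
    and "\<And>t. t \<in> {0<..<1} \<Longrightarrow> g t = c * of_real (f t)"
  shows "primitive (\<lambda>t. c * of_real (h t)) g"
proof (rule primitive_cong[OF primitive_cmult])
  have "continuous_on {0..<1} h"
    using assms(1) by (intro continuous_at_imp_continuous_on ballI) (auto intro: DERIV_isCont)
  then show "primitive (\<lambda>t. of_real (h t)) (\<lambda>t. of_real (f t))"
    using assms(1,2) by (auto simp: primitive_def intro!: continuous_intros has_vector_derivative_of_real)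
qed (simp add: assms)

lemma E_fun_Suc_0: "E_fun (Suc p) 0 = 0"
  by (simp add: E_fun_def eval_fps_at_0 E_series_def)

text \<open>The two families arise alternately by integration against \<open>d\<theta>\<close>, each
  time with a factor \<open>\<i>\<close>. An even number of these factors is rational, an odd number
  leaves one \<open>\<i>\<close>.\<close>

lemma log_span_E_Y:
  "log_span (2 * p) (\<lambda>t. of_real (E_fun p t)) \<and> log_span (2 * p + 1) (\<lambda>t. \<i> * of_real (Y_fun p t))"
proof (induction p)
  case 0
  have *: "log_span 0 (\<lambda>t. of_real (E_fun 0 t))"
    using log_span_one by (simp add: E_fun_def[abs_def] E_series_def)
  have "primitive (\<lambda>t. \<i> * of_real (Y_fun 0 t)) (\<lambda>t. (\<i> * of_real (dang t)) * of_real (E_fun 0 t))"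
    by (rule primitive_of_real[OF deriv_Y_fun]) (auto simp: Y_fun_def)
  from log_span_primitive[OF * log_form_dang this] * show ?case by simp
next
  case (Suc p)
  \<comment> \<open>The constant combines \<open>\<i> * \<i> = - 1\<close> with the factor 4 in
    \<open>deriv_E_fun\<close>.\<close>
  have "primitive (\<lambda>t. (- 1 / 4) * of_real (E_fun (Suc p) t)) (\<lambda>t. (\<i> * of_real (dang t)) * (\<i> * of_real (Y_fun p t)))"
  proof (rule primitive_of_real[OF deriv_E_fun])
    fix t
    have "\<i> * of_real (dang t) * (\<i> * of_real (Y_fun p t)) = (\<i> * \<i>) * of_real (dang t * Y_fun p t)"
      by (simp only: of_real_mult mult_ac)
    then show "\<i> * of_real (dang t) * (\<i> * of_real (Y_fun p t)) =
        (- 1 / 4) * of_real (4 * dang t * Y_fun p t)"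
      by simp
  qed (auto simp: E_fun_Suc_0)
  from log_span_primitive[OF _ log_form_dang this] Suc
  have "log_span (2 * Suc p) (\<lambda>t. (- 1 / 4) * of_real (E_fun (Suc p) t))" by simp
  from log_span_cmult[OF this, of "- 4"]
  have *: "log_span (2 * Suc p) (\<lambda>t. of_real (E_fun (Suc p) t))" by simp
  have "primitive (\<lambda>t. \<i> * of_real (Y_fun (Suc p) t)) (\<lambda>t. (\<i> * of_real (dang t)) * of_real (E_fun (Suc p) t))"
    by (rule primitive_of_real[OF deriv_Y_fun]) (auto simp: Y_fun_def)
  from log_span_primitive[OF * log_form_dang this] * show ?case by simp
qed

text \<open>The first step uses \<open>cot \<theta> * S_fun p 0 = Y_fun p / sin \<theta>\<close>, so
  it integrates \<open>Y_fun p\<close> against \<open>d\<theta> / sin \<theta>\<close> and avoids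
  the quotient by the cosine. Every further step integrates against
  \<open>cot \<theta> d\<theta>\<close>.\<close>

lemma log_span_S: "log_span (2 * p + 2 + j) (\<lambda>t. \<i> * of_real (S_fun p (Suc j) t))"
proof (induction j)
  case 0
  have "primitive (\<lambda>t. \<i> * of_real (S_fun p (Suc 0) t)) (\<lambda>t. 1 / of_real t * (\<i> * of_real (Y_fun p t)))"
  proof (rule primitive_of_real[OF deriv_S_fun])
    fix t :: real
    assume t: "t \<in> {0<..<1}"
    have "sn t = t * dang t" by (simp add: sn_def dang_def)
    with t have "cs t * dang t * eval_fps (S_series p 0) ((sn t)\<^sup>2) = 1 / t * Y_fun p t"
      by (auto simp: Y_fun_def)
    then show "1 / of_real t * (\<i> * of_real (Y_fun p t)) =
        \<i> * of_real (cs t * dang t * eval_fps (S_series p 0) ((sn t)\<^sup>2))"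
      by simp
  qed (auto simp: S_fun_def)
  from log_span_primitive[OF log_span_E_Y[THEN conjunct2] _ this] log_form_inverse show ?case by simp
next
  case (Suc j)
  have "primitive (\<lambda>t. \<i> * of_real (S_fun p (Suc (Suc j)) t))
     (\<lambda>t. of_real (cs t * dang t / sn t) * (\<i> * of_real (S_fun p (Suc j) t)))"
  proof (rule primitive_of_real[OF deriv_S_fun])
    fix t :: real
    assume "t \<in> {0<..<1}"
    then show "of_real (cs t * dang t / sn t) * (\<i> * of_real (S_fun p (Suc j) t)) =
        \<i> * of_real (cs t * dang t * eval_fps (S_series p (Suc j)) ((sn t)\<^sup>2))"
      using sn_pos[of t] by (simp add: S_fun_def)
  qed (auto simp: S_fun_def)
  from log_span_primitive[OF Suc _ this] log_form_cot show ?case by simp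
qed

section \<open>Integration over the unit interval\<close>

lemma filterlim_lsec: "filterlim lsec at_top (at_left 1)"
  unfolding lsec_def[abs_def] cs_def by real_asymp

lemma tendsto_sn: "(sn \<longlongrightarrow> 1) (at_left 1)"
  unfolding sn_def[abs_def] by real_asymp

lemma eventually_at_left_1: "\<forall>\<^sub>F t in at_left (1::real). t \<in> {0<..<1}"
  by (rule eventually_at_leftI[of 0]) auto

text \<open>Since \<open>cs t = exp (- lsec t)\<close> and \<open>lsec\<close> tends to infinity,
  the exponential beats the power.\<close>

lemma tendsto_cs_lsec_power: "((\<lambda>t. cs t * sn t ^ m * (lsec t ^ k / fact k)) \<longlongrightarrow> 0) (at_left 1)"
proof -
  have "((\<lambda>t. lsec t ^ k / exp (lsec t) * sn t ^ m / fact k) \<longlongrightarrow> 0 * 1 ^ m / fact k) (at_left 1)"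
    by (intro tendsto_intros tendsto_sn filterlim_compose[OF tendsto_power_div_exp_0 filterlim_lsec]) auto
  then have "((\<lambda>t. lsec t ^ k / exp (lsec t) * sn t ^ m / fact k) \<longlongrightarrow> 0) (at_left 1)" by simp
  then show ?thesis
  proof (rule Lim_transform_eventually)
    show "\<forall>\<^sub>F t in at_left 1. lsec t ^ k / exp (lsec t) * sn t ^ m / fact k = cs t * sn t ^ m * (lsec t ^ k / fact k)"
      using eventually_at_left_1
      by eventually_elim (use cs_pos in \<open>simp add: lsec_def exp_minus divide_inverse mult_ac\<close>)
  qed
qed

definition sine_log :: "nat \<Rightarrow> nat \<Rightarrow> real \<Rightarrow> real" where
  "sine_log n k t = sn t ^ (2 * n + 1) * (lsec t ^ k / fact k) * dang t"

text \<open>An improper integral over the unit interval, given by the boundary limits of an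
  antiderivative; integration by parts then requires no integrability argument.\<close>

definition has_antideriv :: "(real \<Rightarrow> real) \<Rightarrow> real \<Rightarrow> bool" where
  "has_antideriv f c \<longleftrightarrow> (\<exists>F. (\<forall>t\<in>{0<..<1}. (F has_real_derivative f t) (at t)) \<and>
     (F \<longlongrightarrow> 0) (at_right 0) \<and> (F \<longlongrightarrow> c) (at_left 1))"

text \<open>The boundary term of the integration by parts. Writing \<open>cos\<^sup>2\<close> as
  \<open>1 - sin\<^sup>2\<close> gives the terms for \<open>n - 1\<close> and \<open>n\<close>;
  differentiating the logarithm gives a \<open>1 / cos\<close> that cancels the cosine.\<close>

lemma deriv_sine_log_parts:
  assumes "t \<in> {0..<1}"
  shows "((\<lambda>t. cs t * sn t ^ (2 * n) * (lsec t ^ k / fact k)) has_real_derivative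
    (if n = 0 then 0 else 2 * real n * sine_log (n - 1) k t) +
    (if k = 0 then 0 else sine_log n (k - 1) t) - (2 * real n + 1) * sine_log n k t) (at t)"
proof -
  have c: "(cs t)\<^sup>2 = 1 - (sn t)\<^sup>2" "cs t \<noteq> 0"
    using sn_sq_plus_cs_sq[of t] cs_pos[OF assms] by auto
  have 1: "((\<lambda>t. cs t * sn t ^ (2 * n)) has_real_derivative
     (if n = 0 then 0 else 2 * real n * sn t ^ (2 * (n - 1) + 1) * dang t) -
       (2 * real n + 1) * sn t ^ (2 * n + 1) * dang t) (at t)"
  proof (cases n)
    case 0
    then show ?thesis using has_real_derivative_cs by simp
  next
    case (Suc m)
    have "((\<lambda>t. cs t * sn t ^ (2 * n)) has_real_derivative
        - (sn t * dang t) * sn t ^ (2 * n) + 2 * real n * sn t ^ (2 * m + 1) * (cs t)\<^sup>2 * dang t) (at t)"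
      by (rule derivative_eq_intros has_real_derivative_cs has_real_derivative_sn refl)+
         (simp add: Suc power2_eq_square algebra_simps)
    then show ?thesis
      unfolding c by (rule DERIV_cong) (simp add: Suc power2_eq_square algebra_simps)
  qed
  have 2: "((\<lambda>t. lsec t ^ k / fact k) has_real_derivative
     (if k = 0 then 0 else lsec t ^ (k - 1) / fact (k - 1) * (sn t * dang t / cs t))) (at t)"
    using has_real_derivative_lsec_power[OF assms, of "k - 1"] by (cases k) auto
  show ?thesis
    by (rule DERIV_cong[OF DERIV_mult[OF 1 2]])
       (use c in \<open>auto simp: sine_log_def algebra_simps add_divide_distrib\<close>)
qed

lemma has_antideriv_sine_log_step:
  assumes n: "has_antideriv (\<lambda>t. if n = 0 then 0 else sine_log (n - 1) k t) a"
    and k: "has_antideriv (\<lambda>t. if k = 0 then 0 else sine_log n (k - 1) t) b"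
  shows "has_antideriv (sine_log n k)
    ((2 * real n * a + b + (if n = 0 \<and> k = 0 then 1 else 0)) / (2 * real n + 1))"
proof -
  obtain F G where F: "\<And>t. t \<in> {0<..<1} \<Longrightarrow> (F has_real_derivative (if n = 0 then 0 else sine_log (n - 1) k t)) (at t)"
      "(F \<longlongrightarrow> 0) (at_right 0)" "(F \<longlongrightarrow> a) (at_left 1)"
    and G: "\<And>t. t \<in> {0<..<1} \<Longrightarrow> (G has_real_derivative (if k = 0 then 0 else sine_log n (k - 1) t)) (at t)"
      "(G \<longlongrightarrow> 0) (at_right 0)" "(G \<longlongrightarrow> b) (at_left 1)"
    using n k unfolding has_antideriv_def by blast
  let ?B = "\<lambda>t. cs t * sn t ^ (2 * n) * (lsec t ^ k / fact k)"
  \<comment> \<open>The value of \<open>?B\<close> at 0: it is 1 for \<open>n = k = 0\<close>, where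
    both powers are \<open>0 ^ 0\<close>, and 0 otherwise.\<close>
  let ?e = "if n = 0 \<and> k = 0 then 1 else 0 :: real"
  let ?H = "\<lambda>t. (2 * real n * F t + G t - ?B t + ?e) / (2 * real n + 1)"
  have nz: "2 * real n + 1 \<noteq> 0" by linarith
  show ?thesis
    unfolding has_antideriv_def
  proof (intro exI[of _ ?H] conjI ballI)
    have "(?H \<longlongrightarrow> (2 * real n * 0 + 0 - cs 0 * sn 0 ^ (2 * n) * (lsec 0 ^ k / fact k) + ?e) / (2 * real n + 1)) (at_right 0)"
      by (intro tendsto_intros F G isCont_tendsto_compose[OF DERIV_isCont[OF has_real_derivative_cs]]
          isCont_tendsto_compose[OF DERIV_isCont[OF has_real_derivative_sn]]
          isCont_tendsto_compose[OF DERIV_isCont[OF has_real_derivative_lsec]] nz) auto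
    then show "(?H \<longlongrightarrow> 0) (at_right 0)" by (auto simp: power_0_left)
    have "(?H \<longlongrightarrow> (2 * real n * a + b - 0 + ?e) / (2 * real n + 1)) (at_left 1)"
      by (intro tendsto_intros F G tendsto_cs_lsec_power nz)
    then show "(?H \<longlongrightarrow> (2 * real n * a + b + ?e) / (2 * real n + 1)) (at_left 1)" by simp
    fix t :: real assume t: "t \<in> {0<..<1}"
    have "(?H has_real_derivative (2 * real n * (if n = 0 then 0 else sine_log (n - 1) k t) +
       (if k = 0 then 0 else sine_log n (k - 1) t) - ((if n = 0 then 0 else 2 * real n * sine_log (n - 1) k t) +
    (if k = 0 then 0 else sine_log n (k - 1) t) - (2 * real n + 1) * sine_log n k t) + 0) / (2 * real n + 1)) (at t)"
      by (intro DERIV_cdivide DERIV_add DERIV_diff DERIV_cmult F G t deriv_sine_log_parts DERIV_const) (use t in auto)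
    then show "(?H has_real_derivative sine_log n k t) (at t)"
      by (rule DERIV_cong) (use nz in auto)
  qed
qed

lemma has_antideriv_zero: "has_antideriv (\<lambda>t. 0) 0"
  unfolding has_antideriv_def by (intro exI[of _ "\<lambda>_. 0"]) auto

text \<open>Integration by parts yields the recursion of \<open>t_star\<close> together with that of the Wallis integrals.\<close>

lemma has_antideriv_sine_log:
  "has_antideriv (sine_log n k) (wallis n * t_star (Suc n) (replicate k 1))"
proof (induction n arbitrary: k)
  case 0
  show ?case
  proof (induction k)
    case 0
    show ?case using has_antideriv_sine_log_step[of 0 0 0 0] has_antideriv_zero by simp
  next
    case (Suc k)
    then show ?case
      using has_antideriv_sine_log_step[of 0 "Suc k" 0 "t_star (Suc 0) (replicate k 1)"] has_antideriv_zero
      by (simp add: t_star_Cons_Suc)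
  qed
next
  case (Suc n)
  have nz: "2 * real n + 3 \<noteq> 0" by linarith
  show ?case
  proof (induction k)
    case 0
    show ?case
      using has_antideriv_sine_log_step[of "Suc n" 0 "wallis n" 0] Suc[of 0] has_antideriv_zero
      by (simp add: wallis_Suc algebra_simps)
  next
    case (Suc k)
    \<comment> \<open>The recursion of \<open>t_star (n + 2)\<close> multiplied by
      \<open>wallis (Suc n)\<close>, with the recursion of \<open>wallis\<close> absorbed into the
      first summand.\<close>
    have "(2 * real (Suc n) * (wallis n * t_star (Suc n) (replicate (Suc k) 1)) +
        wallis (Suc n) * t_star (Suc (Suc n)) (replicate k 1)) / (2 * real (Suc n) + 1) =
        wallis (Suc n) * t_star (Suc (Suc n)) (replicate (Suc k) 1)"
    proof -
      have *: "2 * real (Suc n) + 1 = 2 * real n + 3" by simp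
      have "wallis (Suc n) * x = 2 * real (Suc n) * (wallis n * x) / (2 * real n + 3)" for x
        by (simp add: wallis_Suc algebra_simps)
      then show ?thesis
        by (simp add: t_star_Cons_Suc[of "Suc n"] * distrib_left add_divide_distrib del: of_nat_Suc)
    qed
    then show ?case
      using has_antideriv_sine_log_step[of "Suc n" "Suc k"
          "wallis n * t_star (Suc n) (replicate (Suc k) 1)" "wallis (Suc n) * t_star (Suc (Suc n)) (replicate k 1)"]
        Suc \<open>\<And>k. has_antideriv (sine_log n k) (wallis n * t_star (Suc n) (replicate k 1))\<close>[of "Suc k"]
      by (simp del: replicate_Suc of_nat_Suc)
  qed
qed

section \<open>Termwise integration and membership of the value\<close>

lemma has_antideriv_integral:
  assumes "has_antideriv f c" "continuous_on {0<..<1} f" "\<And>t. t \<in> {0<..<1} \<Longrightarrow> 0 \<le> f t"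
  shows "set_integrable lborel {0<..<1} f" "(LINT t:{0<..<1}|lborel. f t) = c"
proof -
  obtain F where F: "\<And>t. t \<in> {0<..<1} \<Longrightarrow> (F has_real_derivative f t) (at t)" "(F \<longlongrightarrow> 0) (at_right 0)" "(F \<longlongrightarrow> c) (at_left 1)"
    using assms(1) unfolding has_antideriv_def by blast
  have e: "einterval 0 1 = {0<..<1}"
    by (auto simp: einterval_def)
  have lims: "((F \<circ> real_of_ereal) \<longlongrightarrow> 0) (at_right 0)" "((F \<circ> real_of_ereal) \<longlongrightarrow> c) (at_left 1)"
    using F(2,3) ereal_tendsto_simps1(2)[of F 0 0] ereal_tendsto_simps1(1)[of F c 1]
    by (simp_all add: zero_ereal_def one_ereal_def)
  have cont: "isCont f t" if "t \<in> {0<..<1}" for t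
    using assms(2) that by (simp add: continuous_on_eq_continuous_at)
  have "set_integrable lborel (einterval 0 1) f" "(LBINT t=0..1. f t) = c - 0"
    by (rule interval_integral_FTC_nonneg[OF _ _ _ _ lims];
        use F(1) cont assms(3) in \<open>auto simp: zero_ereal_def one_ereal_def\<close>)+
  then show "set_integrable lborel {0<..<1} f" "(LINT t:{0<..<1}|lborel. f t) = c"
    by (simp_all add: e interval_lebesgue_integral_def)
qed

text \<open>The terms are nonnegative, so the limit \<open>g\<close> itself dominates all partial
  sums; its integrability follows from its own antiderivative.\<close>

lemma sums_of_has_antideriv:
  fixes f :: "nat \<Rightarrow> real \<Rightarrow> real"
  assumes f: "\<And>n. has_antideriv (f n) (a n)" "\<And>n. continuous_on {0<..<1} (f n)"
    "\<And>n t. t \<in> {0<..<1} \<Longrightarrow> 0 \<le> f n t"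
    and g: "has_antideriv g c" "continuous_on {0<..<1} g"
    and sums: "\<And>t. t \<in> {0<..<1} \<Longrightarrow> (\<lambda>n. f n t) sums g t"
  shows "a sums c"
proof -
  have g0: "0 \<le> g t" if "t \<in> {0<..<1}" for t
    using sums_le[OF _ sums_zero sums[OF that]] f(3)[OF that] by simp
  note intf = has_antideriv_integral[OF f] and intg = has_antideriv_integral[OF g g0]
  let ?I = "indicator {0<..<1} :: real \<Rightarrow> real"
  have "(\<lambda>N. LINT t|lborel. (\<Sum>n<N. ?I t *\<^sub>R f n t)) \<longlonglongrightarrow> (LINT t|lborel. ?I t *\<^sub>R g t)"
  proof (rule integral_dominated_convergence[where w = "\<lambda>t. ?I t *\<^sub>R g t"])
    show "integrable lborel (\<lambda>t. ?I t *\<^sub>R g t)" "(\<lambda>t. ?I t *\<^sub>R g t) \<in> borel_measurable lborel"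
      using intg(1) by (auto simp: set_integrable_def)
    show "(\<lambda>t. \<Sum>n<N. ?I t *\<^sub>R f n t) \<in> borel_measurable lborel" for N
      using intf(1) by (intro borel_measurable_sum) (auto simp: set_integrable_def)
    have "(\<lambda>n. ?I t *\<^sub>R f n t) sums (?I t *\<^sub>R g t)" for t
      using sums[of t] by (auto simp: indicator_def)
    then show "AE t in lborel. (\<lambda>N. \<Sum>n<N. ?I t *\<^sub>R f n t) \<longlonglongrightarrow> ?I t *\<^sub>R g t"
      by (simp add: sums_def)
    have "norm (\<Sum>n<N. ?I t *\<^sub>R f n t) \<le> ?I t *\<^sub>R g t" for N t
    proof (cases "t \<in> {0<..<1}")
      case True
      then have "(\<Sum>n<N. f n t) \<le> g t" "0 \<le> (\<Sum>n<N. f n t)"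
        using sum_le_suminf[OF sums_summable[OF sums], of t "{..<N}"] sums[of t] f(3)
        by (auto simp: sums_iff intro: sum_nonneg)
      then show ?thesis using True by simp
    qed simp
    then show "AE t in lborel. norm (\<Sum>n<N. ?I t *\<^sub>R f n t) \<le> ?I t *\<^sub>R g t" for N by simp
  qed
  moreover have "(LINT t|lborel. (\<Sum>n<N. ?I t *\<^sub>R f n t)) = (\<Sum>n<N. a n)" for N
    using intf by (subst Bochner_Integration.integral_sum) (auto simp: set_integrable_def set_lebesgue_integral_def)
  moreover have "(LINT t|lborel. ?I t *\<^sub>R g t) = c"
    using intg(2) by (simp add: set_lebesgue_integral_def)
  ultimately show ?thesis by (simp add: sums_def)
qed

lemma has_antideriv_of_polylog_span:
  assumes "polylog_span n (\<lambda>t. \<i> * of_real (f t))"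
  obtains y where "has_antideriv (\<lambda>t. f t * dang t) y" "of_real y \<in> CMZV 4 (Suc n)"
proof -
  interpret Q: vector_space rat_scale by (rule vector_space_rat_scale)
  obtain h x where h: "primitive h (\<lambda>t. \<i> * of_real (dang t) * (\<i> * of_real (f t)))"
    and x: "x \<in> CMZV 4 (Suc n)" and lim: "(h \<longlongrightarrow> x) (at_left 1)"
    using polylog_span_dang_limit[OF assms] .
  have "\<i> * of_real (dang t) * (\<i> * of_real (f t)) = (\<i> * \<i>) * of_real (f t * dang t)" for t
    by (simp only: of_real_mult mult_ac)
  then have h: "primitive h (\<lambda>t. - of_real (f t * dang t))"
    by (intro primitive_cong[OF h]) simp
  \<comment> \<open>The two factors \<open>\<i>\<close> make the integrand real, so the conjugate is
    a primitive of the same function. Hence \<open>h\<close> and its limit are real.\<close>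
  have "primitive (\<lambda>t. cnj (h t)) (\<lambda>t. - of_real (f t * dang t))"
    using h bounded_linear.has_vector_derivative[OF bounded_linear_cnj, of h]
    by (fastforce simp: primitive_def intro!: continuous_intros)
  from primitive_unique[OF this h] have cnj: "cnj (h t) = h t" if "t \<in> {0..<1}" for t
    using that by simp
  have "(h \<longlongrightarrow> cnj x) (at_left 1)"
    by (rule Lim_transform_eventually[OF tendsto_cnj[OF lim]])
       (use eventually_at_left_1 in eventually_elim, simp add: cnj)
  then have "x = cnj x"
    using lim tendsto_unique trivial_limit_at_left_real by blast
  then have "of_real (- Re x) = - x" by (simp add: complex_eq_iff)
  moreover have "- x \<in> CMZV 4 (Suc n)"
    using x unfolding CMZV_def by (rule Q.span_neg)
  moreover have "has_antideriv (\<lambda>t. f t * dang t) (- Re x)"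
    unfolding has_antideriv_def
  proof (intro exI[of _ "\<lambda>t. - Re (h t)"] conjI ballI)
    show "((\<lambda>t. - Re (h t)) \<longlongrightarrow> - Re x) (at_left 1)"
      by (intro tendsto_intros lim)
    have "(h \<longlongrightarrow> 0) (at 0 within {0..<1})"
      using h unfolding primitive_def continuous_on_def
      by (metis atLeastLessThan_iff order_refl zero_less_one)
    then have "(h \<longlongrightarrow> 0) (at 0 within {0..1/2})"
      by (rule tendsto_within_subset) auto
    then have "(h \<longlongrightarrow> 0) (at_right 0)"
      by (simp add: at_within_Icc_at_right)
    then have "((\<lambda>t. - Re (h t)) \<longlongrightarrow> - Re 0) (at_right 0)"
      by (intro tendsto_intros)
    then show "((\<lambda>t. - Re (h t)) \<longlongrightarrow> 0) (at_right 0)" by simp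
    fix t :: real assume "t \<in> {0<..<1}"
    then have "(h has_vector_derivative - of_real (f t * dang t)) (at t)"
      using h by (simp add: primitive_def)
    from bounded_linear.has_vector_derivative[OF bounded_linear_Re this]
    have "((\<lambda>t. Re (h t)) has_real_derivative - (f t * dang t)) (at t)"
      by (simp add: has_real_derivative_iff_has_vector_derivative)
    from DERIV_minus[OF this] show "((\<lambda>t. - Re (h t)) has_real_derivative f t * dang t) (at t)"
      by simp
  qed
  ultimately show ?thesis using that[of "- Re x"] by simp
qed

theorem theorem9p18:
  fixes s p k :: nat
  assumes "p \<ge> 1"
  shows "\<exists>x \<in> CMZV 4 (s + 2 * p + k + 1).
    (\<lambda>n. complex_of_real ((4 ^ n / real ((2 * n) choose n))\<^sup>2 *
        (t_star (n + 1) (replicate k 1) * zeta_trunc n (replicate (p - 1) 2)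
          / (2 * real n + 1) ^ (s + 3)))) sums x"
proof -
  define q where "q = p - 1"
  have p: "p = Suc q" using assms by (simp add: q_def)
  \<comment> \<open>The weight is \<open>2 * q + 2 + s\<close> from \<open>S_fun\<close> and
    \<open>k\<close> from the logarithm, together \<open>s + 2 * p + k\<close>; the outer
    \<open>d\<theta>\<close> adds the last unit.\<close>
  define f where "f t = lsec t ^ k / fact k * S_fun q (Suc s) t" for t
  have span: "polylog_span (s + 2 * p + k) (\<lambda>t. \<i> * of_real (f t))"
    using log_span_S[of q s, unfolded log_span_def, rule_format, of k] by (simp add: p f_def mult_ac add_ac)
  have "continuous_on {0..<1} (S_fun q (Suc s))"
    by (intro continuous_at_imp_continuous_on ballI DERIV_isCont[OF deriv_S_fun])
  then have cont: "continuous_on {0..<1} f"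
    unfolding f_def by (intro continuous_intros) auto
  have cont_dang: "continuous_on {0<..<1} dang" "continuous_on {0<..<1} sn"
    unfolding dang_def[abs_def] sn_def[abs_def] by (auto intro!: continuous_intros)
  have cont': "continuous_on {0<..<1} f" "continuous_on {0<..<1} lsec"
    using cont continuous_on_lsec by (auto elim: continuous_on_subset)
  obtain y where y: "has_antideriv (\<lambda>t. f t * dang t) y" "of_real y \<in> CMZV 4 (Suc (s + 2 * p + k))"
    using has_antideriv_of_polylog_span[OF span] .
  \<comment> \<open>One \<open>wallis n\<close> comes from this coefficient and a second one from
    the sine integral. Each contributes a factor \<open>2 * n + 1\<close> to the denominator, which
    raises the exponent from \<open>s + 1\<close> to \<open>s + 3\<close>.\<close>
  define b where "b n = wallis n * zeta2 q n / (2 * real n + 1) ^ Suc s" for n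
  have "(\<lambda>n. b n * (wallis n * t_star (Suc n) (replicate k 1))) sums y"
  proof (rule sums_of_has_antideriv[OF _ _ _ y(1)])
    fix n
    obtain F where F: "\<And>t. t \<in> {0<..<1} \<Longrightarrow> (F has_real_derivative sine_log n k t) (at t)" "(F \<longlongrightarrow> 0) (at_right 0)"
      "(F \<longlongrightarrow> wallis n * t_star (Suc n) (replicate k 1)) (at_left 1)"
      using has_antideriv_sine_log[of n k] unfolding has_antideriv_def by blast
    then show "has_antideriv (\<lambda>t. b n * sine_log n k t) (b n * (wallis n * t_star (Suc n) (replicate k 1)))"
      unfolding has_antideriv_def
      by (intro exI[of _ "\<lambda>t. b n * F t"]) (auto intro!: tendsto_mult_left tendsto_mult_right_zero DERIV_cmult)
    show "continuous_on {0<..<1} (\<lambda>t. b n * sine_log n k t)"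
      unfolding sine_log_def[abs_def] by (intro continuous_intros cont_dang cont') auto
    fix t :: real assume t: "t \<in> {0<..<1}"
    then show "0 \<le> b n * sine_log n k t"
      using lsec_nonneg[of t] sn_nonneg[of t] dang_pos[of t] wallis_nonneg[of n] zeta2_nonneg[of n q]
      by (auto simp: b_def sine_log_def)
  next
    show "continuous_on {0<..<1} (\<lambda>t. f t * dang t)"
      by (intro continuous_intros cont_dang cont')
  next
    fix t :: real assume "t \<in> {0<..<1}"
    then have "(\<lambda>n. fps_nth (S_series q (Suc s)) n * ((sn t)\<^sup>2) ^ n) sums eval_fps (S_series q (Suc s)) ((sn t)\<^sup>2)"
      by (intro sums_eval_fps less_one_conv_radius one_le_conv_radius_S_series) auto
    from sums_mult[OF this, of "sn t * (lsec t ^ k / fact k) * dang t"]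
    show "(\<lambda>n. b n * sine_log n k t) sums (f t * dang t)"
      by (simp add: b_def sine_log_def f_def S_fun_def S_series_def mult_ac flip: power_mult)
  qed
  moreover have "b n * (wallis n * t_star (Suc n) (replicate k 1)) =
      (4 ^ n / real ((2 * n) choose n))\<^sup>2 *
        (t_star (n + 1) (replicate k 1) * zeta_trunc n (replicate (p - 1) 2) / (2 * real n + 1) ^ (s + 3))" for n
    by (simp add: b_def wallis_def p power2_eq_square power_add eval_nat_numeral mult_ac)
  ultimately have "(\<lambda>n. complex_of_real ((4 ^ n / real ((2 * n) choose n))\<^sup>2 *
        (t_star (n + 1) (replicate k 1) * zeta_trunc n (replicate (p - 1) 2)
          / (2 * real n + 1) ^ (s + 3)))) sums of_real y"
    by (intro sums_of_real) simp
  then show ?thesis using y(2) by (intro bexI[of _ "of_real y"]) auto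
qed

end
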